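(* Let $(K;\mathcal{T})$ be a triangulated 3-dimensional pseudo-manifold (with or without boundary) and let $(A,\kappa)$ be prescribed area-curvature functions with the property that $A\ge 0$. (1) If $\chi^*(s)\le\chi^{(A,\kappa)}(s)$ for all $s\in C(K;\mathcal{T})$ with all quadrilateral coordinates non-negative, then $(K;\mathcal{T})$ admits a semi-angle structure with area-curvature $(A,\kappa)$. (2) If $\chi^*(s)<\chi^{(A,\kappa)}(s)$ for all $s\in C(K;\mathcal{T})$ with all quadrilateral coordinates non-negative and at least one quadrilateral coordinate positive, then $(K;\mathcal{T})$ admits an angle structure with area-curvature $(A,\kappa)$.
   Context: **Pseudo-manifolds.** Let $X$ be a disjoint union of compact 3-simplices $\sigma^3_1,\dots,\sigma^3_t$ and $\Phi=\{\phi_1,\dots,\phi_r\}$ a collection of affine isomorphisms $\phi_i:\tau_i\to\delta_i$ between distinct codimension-one faces of the simplices, with $\{\tau_i,\delta_i\}\cap\{\tau_j,\delta_j\}=\emptyset$ for $i\ne j$. The quotient $K=X/\Phi$ is a compact 3-dimensional pseudo-manifold and the images of the simplices and their sub-simplices form its triangulation $\mathcal{T}$, with cells called vertices, edges, triangles, tetrahedra. It has boundary (the images of unpaired faces) if some face is unpaired; otherwise it is closed. Let $e_1,\dots,e_n$ be the edges. **Normal disc types.** A normal disc in a tetrahedron is a properly embedded disc meeting each face in one normal arc (a properly embedded arc joining the interiors of two distinct edges of the face) or not at all. Up to normal isotopy (isotopy preserving each cell) each tetrahedron has four normal triangle types (each cutting off a corner and meeting the three edges there) and three normal quadrilateral types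 (each separating a pair of opposite edges and meeting the other four edges). A quadrilateral type faces the two edges of its tetrahedron disjoint from it. Let $N_\square=\{q_1,\dots,q_{3t}\}$ and $N_\Delta=\{p_1,\dots,p_{4t}\}$ be the sets of all quadrilateral and triangle types in $\mathcal{T}$. Identify these types with the standard basis vectors of $\mathbb{R}^{7t}$ (quadrilaterals first). **Solution space.** $C(K;\mathcal{T})\subset\mathbb{R}^{7t}$ is the vector space of all $(x_1,\dots,x_{3t},y_1,\dots,y_{4t})$ satisfying, for each pairing $\phi:\tau\to\delta$ in $\Phi$ (with $\tau\subset\sigma^3_i$, $\delta\subset\sigma^3_j$) and each normal arc type in the resulting triangle, $x_q+y_p=x_{q'}+y_{p'}$, where $q,p$ are the quadrilateral and triangle types in $\sigma^3_i$ meeting $\tau$ in that arc type and $q',p'$ those in $\sigma^3_j$ meeting $\delta$ in that arc type. The $x_i$ are the quadrilateral coordinates; $y_p(s)$ denotes the coordinate of $s$ at the triangle type $p$. For each tetrahedron $\sigma^3$, $W_{\sigma^3}$ is the sum of its four triangle types minus the sum of its three quadrilateral types. For each edge $e$ of degree $k$ (formed by gluing $k$ edges $\tilde e_1,\dots,\tilde e_k$ of the unglued tetrahedra), $W_e=\sum_{i=1}^k(p_{s_i}+p_{r_i}-q_{l_i})$, where in the tetrahedron containing $\tilde e_i$, $q_{l_i}$ is the quadrilateral type disjoint from $\tilde e_i$ and $p_{s_i},p_{r_i}$ are the two triangle types meeting $\tilde e_i$. By a theorem of Kang and Rubinstein, $W_{\sigma^3_1},\dots,W_{\sigma^3_t},W_{e_1},\dots,W_{e_n}$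 is a basis of $C(K;\mathcal{T})$. **Generalised Euler characteristic.** $\chi^*:\mathbb{R}^{7t}\to\mathbb{R}$ is the linear function $\chi^*(x,y)=\sum_i x_i\chi^*(q_i)+\sum_j y_j\chi^*(p_j)$, where, with $d(e)$ the degree of $e$ and $b(D)$ the number of normal arcs in $D\cap\partial K$, $\chi^*(p)=-\tfrac12(1+b(p))+\sum_{a=0}^2\tfrac1{d(e_a)}$ for a triangle type meeting edges $e_0,e_1,e_2$ (with multiplicity) and $\chi^*(q)=-\tfrac12(2+b(q))+\sum_{a=0}^3\tfrac1{d(e_a)}$ for a quadrilateral type meeting edges $e_0,\dots,e_3$ (with multiplicity). **Angle structures with area-curvature $(A,\kappa)$.** A quadrilateral disc separates the interior of a 3-simplex into two wedges; up to normal isotopy there are six wedges in each 3-simplex, one for each edge of it. A generalised angle structure on $(K;\mathcal{T})$ is a real-valued function on the set of all wedges (of all tetrahedra). The combinatorial area of a triangle type is the sum of the angles of the three wedges at the three edges it meets, minus $\pi$. The curvature at an edge $e$ is $2\pi$ (if the interior of $e$ lies in the interior of $K$) or $\pi$ (if $e\subset\partial K$) minus the sum of the angles of all wedges containing $e$. Prescribed area-curvature functions $(A,\kappa)$ are functions $A:N_\Delta\to\mathbb{R}$ and $\kappa:\{\text{edges}\}\to\mathbb{R}$; $A\ge0$ means $A(p)\ge 0$ for all $p\in N_\Delta$. A generalised angle structure has area-curvature $(A,\kappa)$ if its areas of normal triangle types and curvatures at edges are given by $A$ and $\kappa$; it is a semi-angle structure (respectively angle structure) with area-curvature $(A,\kappa)$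 if in addition all its angles are non-negative (respectively positive). **The function $\chi^{(A,\kappa)}$.** It is the linear function on $C(K;\mathcal{T})$ given, for $s=\sum_{i=1}^t w_iW_{\sigma^3_i}+\sum_{j=1}^n z_jW_{e_j}$, by $\chi^{(A,\kappa)}(s)=\frac1{2\pi}\Big(\sum_{p\in N_\Delta}y_p(s)A(p)+\sum_{j=1}^n 2z_j\kappa(e_j)\Big)$. *)

theory Defs
  imports "HOL-Analysis.Analysis"
begin

text \<open>
  The 3-simplices are the elements of a finite type \<open>'t\<close> and the vertices of each of them are
  the four elements of the type \<open>4\<close>. A cell of the disjoint union of the simplices is a pair
  of a simplex and a set of its vertices. An affine isomorphism of codimension-one faces is
  determined by the bijection it induces on vertices, so a face pairing is recorded as source
  face, target face and vertex map; the values of the vertex map off the source face are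
  irrelevant. The pair \<open>(K, \<T>)\<close> is given by the set \<open>\<Phi>\<close> of face pairings.
\<close>

type_synonym 't cell = "'t \<times> 4 set"

type_synonym 't pairing = "'t cell \<times> 't cell \<times> (4 \<Rightarrow> 4)"

definition simplex_edges :: "4 set set" where
  "simplex_edges = {e. card e = 2}"

definition simplex_faces :: "4 set set" where
  "simplex_faces = {F. card F = 3}"

definition triangulated_pseudo_manifold :: "'t pairing set \<Rightarrow> bool" where
  "triangulated_pseudo_manifold \<Phi> \<longleftrightarrow>
     (\<forall>(\<tau>, \<delta>, f) \<in> \<Phi>. snd \<tau> \<in> simplex_faces \<and> snd \<delta> \<in> simplex_faces \<and> \<tau> \<noteq> \<delta> \<and>
        bij_betw f (snd \<tau>) (snd \<delta>)) \<and>
     (\<forall>(\<tau>, \<delta>, f) \<in> \<Phi>. \<forall>(\<tau>', \<delta>', f') \<in> \<Phi>.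
        (\<tau>, \<delta>, f) \<noteq> (\<tau>', \<delta>', f') \<longrightarrow> {\<tau>, \<delta>} \<inter> {\<tau>', \<delta>'} = {})"

definition unpaired_faces :: "'t pairing set \<Rightarrow> 't cell set" where
  "unpaired_faces \<Phi> =
     {\<tau>. snd \<tau> \<in> simplex_faces \<and> (\<forall>(\<tau>', \<delta>', f) \<in> \<Phi>. \<tau> \<noteq> \<tau>' \<and> \<tau> \<noteq> \<delta>')}"

text \<open>
  An edge of \<open>K\<close> is represented by the set of all simplex edges that are glued to form it;
  orientations play no role.
\<close>

definition edge_gluing :: "'t pairing set \<Rightarrow> 't cell rel" where
  "edge_gluing \<Phi> = {((\<sigma>, e), (\<sigma>', f ` e)) | \<sigma> e \<sigma>' f.
     e \<in> simplex_edges \<and> (\<exists>F F'. ((\<sigma>, F), (\<sigma>', F'), f) \<in> \<Phi> \<and> e \<subseteq> F)}"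

definition edge_equiv :: "'t pairing set \<Rightarrow> 't cell rel" where
  "edge_equiv \<Phi> = (edge_gluing \<Phi> \<union> (edge_gluing \<Phi>)\<inverse>)\<^sup>*"

definition edges :: "'t pairing set \<Rightarrow> 't cell set set" where
  "edges \<Phi> = (UNIV \<times> simplex_edges) // edge_equiv \<Phi>"

definition edge_class :: "'t pairing set \<Rightarrow> 't cell \<Rightarrow> 't cell set" where
  "edge_class \<Phi> e = edge_equiv \<Phi> `` {e}"

definition edge_degree :: "'t cell set \<Rightarrow> nat" where
  "edge_degree e = card e"

definition boundary_edge :: "'t pairing set \<Rightarrow> 't cell set \<Rightarrow> bool" where
  "boundary_edge \<Phi> e \<longleftrightarrow> (\<exists>(\<sigma>, e') \<in> e. \<exists>F. (\<sigma>, F) \<in> unpaired_faces \<Phi> \<and> e' \<subseteq> F)"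

text \<open>
  A normal disc type in a simplex is determined by the partition of the four vertices into the
  two sides of the disc: \<open>{{v}, -{v}}\<close> for the triangle type at the corner \<open>v\<close>, and \<open>{S, -S}\<close>
  with \<open>S\<close> an edge for the quadrilateral type separating \<open>S\<close> from the opposite edge. The disc
  meets precisely the edges whose endpoints are on different sides. A normal arc type in a face
  is identified with the vertex of the face that it separates from the other two.
\<close>

typedef quad = "{{S, -S} | S. S \<in> simplex_edges}"
  morphisms quad_sides Abs_quad
proof -
  have "card {0, 1 :: 4} = 2"
    by simp
  then show ?thesis
    unfolding simplex_edges_def by blast
qed

instance quad :: finite
proof
  have "inj quad_sides"
    by (simp add: inj_def quad_sides_inject)
  then show "finite (UNIV :: quad set)"
    by (rule finite_imageD[rotated]) simp
qed

definition triangle_sides :: "4 \<Rightarrow> 4 set set" where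
  "triangle_sides v = {{v}, -{v}}"

definition meets_edge :: "4 set set \<Rightarrow> 4 set \<Rightarrow> bool" where
  "meets_edge D e \<longleftrightarrow> (\<exists>S \<in> D. e \<inter> S \<noteq> {} \<and> e - S \<noteq> {})"

definition meets_face_in_arc :: "4 set set \<Rightarrow> 4 set \<Rightarrow> 4 \<Rightarrow> bool" where
  "meets_face_in_arc D F v \<longleftrightarrow> (\<exists>S \<in> D. S \<inter> F = {v})"

type_synonym 't normal_type = "('t \<times> quad) + ('t \<times> 4)"

type_synonym 't normal_vec = "real ^ ('t normal_type)"

abbreviation quad_coord :: "'t::finite normal_vec \<Rightarrow> 't \<times> quad \<Rightarrow> real" where
  "quad_coord s q \<equiv> s $ Inl q"

abbreviation tri_coord :: "'t::finite normal_vec \<Rightarrow> 't \<times> 4 \<Rightarrow> real" where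
  "tri_coord s p \<equiv> s $ Inr p"

abbreviation quad_vec :: "'t::finite \<times> quad \<Rightarrow> 't normal_vec" where
  "quad_vec q \<equiv> axis (Inl q) 1"

abbreviation tri_vec :: "'t::finite \<times> 4 \<Rightarrow> 't normal_vec" where
  "tri_vec p \<equiv> axis (Inr p) 1"

definition solution_space :: "'t::finite pairing set \<Rightarrow> 't normal_vec set" where
  "solution_space \<Phi> = {s. \<forall>((\<sigma>, F), (\<sigma>', F'), f) \<in> \<Phi>. \<forall>v \<in> F. \<forall>q p q' p'.
     meets_face_in_arc (quad_sides q) F v \<longrightarrow>
     meets_face_in_arc (triangle_sides p) F v \<longrightarrow>
     meets_face_in_arc (quad_sides q') F' (f v) \<longrightarrow>
     meets_face_in_arc (triangle_sides p') F' (f v) \<longrightarrow>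
     quad_coord s (\<sigma>, q) + tri_coord s (\<sigma>, p) =
     quad_coord s (\<sigma>', q') + tri_coord s (\<sigma>', p')}"

definition W_tet :: "'t::finite \<Rightarrow> 't normal_vec" where
  "W_tet \<sigma> = (\<Sum>v\<in>UNIV. tri_vec (\<sigma>, v)) - (\<Sum>q\<in>UNIV. quad_vec (\<sigma>, q))"

text \<open>In each summand, exactly one quadrilateral type is disjoint from the simplex edge.\<close>

definition W_edge :: "'t::finite cell set \<Rightarrow> 't normal_vec" where
  "W_edge e = (\<Sum>(\<sigma>, e') \<in> e.
     (\<Sum>v | meets_edge (triangle_sides v) e'. tri_vec (\<sigma>, v)) -
     (\<Sum>q | \<not> meets_edge (quad_sides q) e'. quad_vec (\<sigma>, q)))"

definition boundary_arcs :: "'t pairing set \<Rightarrow> 't \<Rightarrow> 4 set set \<Rightarrow> nat" where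
  "boundary_arcs \<Phi> \<sigma> D =
     card {F. (\<sigma>, F) \<in> unpaired_faces \<Phi> \<and> (\<exists>v. meets_face_in_arc D F v)}"

text \<open>
  Summing over the edges of the simplex, rather than over edges of \<open>K\<close>, accounts for the
  multiplicities.
\<close>

definition inverse_degree_sum :: "'t pairing set \<Rightarrow> 't \<Rightarrow> 4 set set \<Rightarrow> real" where
  "inverse_degree_sum \<Phi> \<sigma> D =
     (\<Sum>e | e \<in> simplex_edges \<and> meets_edge D e. 1 / real (edge_degree (edge_class \<Phi> (\<sigma>, e))))"

fun chi_star_type :: "'t pairing set \<Rightarrow> 't normal_type \<Rightarrow> real" where
  "chi_star_type \<Phi> (Inl (\<sigma>, q)) =
     - (1/2) * (2 + real (boundary_arcs \<Phi> \<sigma> (quad_sides q))) +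
     inverse_degree_sum \<Phi> \<sigma> (quad_sides q)"
| "chi_star_type \<Phi> (Inr (\<sigma>, v)) =
     - (1/2) * (1 + real (boundary_arcs \<Phi> \<sigma> (triangle_sides v))) +
     inverse_degree_sum \<Phi> \<sigma> (triangle_sides v)"

definition chi_star :: "'t::finite pairing set \<Rightarrow> 't normal_vec \<Rightarrow> real" where
  "chi_star \<Phi> s = (\<Sum>q\<in>UNIV. quad_coord s q * chi_star_type \<Phi> (Inl q)) +
                  (\<Sum>p\<in>UNIV. tri_coord s p * chi_star_type \<Phi> (Inr p))"

text \<open>
  There is one wedge for each edge of each simplex. Generalised angle structures are functions
  on cells of which only the values on \<open>UNIV \<times> simplex_edges\<close> are used. Likewise \<open>\<kappa>\<close> is only
  evaluated on \<open>edges \<Phi>\<close>.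
\<close>

definition tri_area :: "('t cell \<Rightarrow> real) \<Rightarrow> 't \<times> 4 \<Rightarrow> real" where
  "tri_area \<theta> p =
     (\<Sum>e | e \<in> simplex_edges \<and> meets_edge (triangle_sides (snd p)) e. \<theta> (fst p, e)) - pi"

definition edge_curvature ::
  "'t pairing set \<Rightarrow> ('t cell \<Rightarrow> real) \<Rightarrow> 't cell set \<Rightarrow> real" where
  "edge_curvature \<Phi> \<theta> e = (if boundary_edge \<Phi> e then pi else 2 * pi) - (\<Sum>w\<in>e. \<theta> w)"

definition has_area_curvature ::
  "'t pairing set \<Rightarrow> ('t \<times> 4 \<Rightarrow> real) \<Rightarrow> ('t cell set \<Rightarrow> real) \<Rightarrow> ('t cell \<Rightarrow> real) \<Rightarrow> bool" where
  "has_area_curvature \<Phi> A \<kappa> \<theta> \<longleftrightarrow>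
     (\<forall>p. tri_area \<theta> p = A p) \<and> (\<forall>e \<in> edges \<Phi>. edge_curvature \<Phi> \<theta> e = \<kappa> e)"

definition semi_angle_structure ::
  "'t pairing set \<Rightarrow> ('t \<times> 4 \<Rightarrow> real) \<Rightarrow> ('t cell set \<Rightarrow> real) \<Rightarrow> ('t cell \<Rightarrow> real) \<Rightarrow> bool" where
  "semi_angle_structure \<Phi> A \<kappa> \<theta> \<longleftrightarrow>
     has_area_curvature \<Phi> A \<kappa> \<theta> \<and> (\<forall>w \<in> UNIV \<times> simplex_edges. \<theta> w \<ge> 0)"

definition angle_structure ::
  "'t pairing set \<Rightarrow> ('t \<times> 4 \<Rightarrow> real) \<Rightarrow> ('t cell set \<Rightarrow> real) \<Rightarrow> ('t cell \<Rightarrow> real) \<Rightarrow> bool" where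
  "angle_structure \<Phi> A \<kappa> \<theta> \<longleftrightarrow>
     has_area_curvature \<Phi> A \<kappa> \<theta> \<and> (\<forall>w \<in> UNIV \<times> simplex_edges. \<theta> w > 0)"

text \<open>
  The description below determines a unique value on the solution space because, by a theorem
  of Kang and Rubinstein, the vectors \<open>W_tet \<sigma>\<close> and \<open>W_edge e\<close> form a basis of it. Only
  arguments in the solution space are meaningful.
\<close>

definition chi_area_curvature ::
  "'t::finite pairing set \<Rightarrow> ('t \<times> 4 \<Rightarrow> real) \<Rightarrow> ('t cell set \<Rightarrow> real) \<Rightarrow> 't normal_vec \<Rightarrow> real" where
  "chi_area_curvature \<Phi> A \<kappa> s = (THE r. \<exists>w z.
     s = (\<Sum>\<sigma>\<in>UNIV. w \<sigma> *\<^sub>R W_tet \<sigma>) + (\<Sum>e\<in>edges \<Phi>. z e *\<^sub>R W_edge e) \<and>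
     r = 1 / (2 * pi) * ((\<Sum>p\<in>UNIV. tri_coord s p * A p) + (\<Sum>e\<in>edges \<Phi>. 2 * z e * \<kappa> e)))"

end

theory Submission
  imports Defs
begin

text \<open>
  Prescribing areas and curvatures is a linear system for the angles, with one unknown for each
  wedge, so the existence of non-negative or of positive solutions is decided by linear
  programming duality (\<open>farkas_nonneg\<close>, \<open>farkas_pos\<close>). A dual variable assigns a number \<open>a(p)\<close>
  to each triangle type \<open>p\<close> and a number \<open>\<zeta>(e)\<close> to each edge \<open>e\<close> of \<open>K\<close>, and it is feasible if for
  each wedge the sum of \<open>a\<close> at the two endpoints of its edge and of \<open>\<zeta>\<close> at that edge is
  non-negative.

  The link with normal surfaces is that a feasible dual variable yields the vector
  \<open>s = \<Sum>\<^sub>\<sigma> w\<^sub>\<sigma> W\<^sub>\<sigma> + \<Sum>\<^sub>e z\<^sub>e W\<^sub>e\<close> of the solution space, where \<open>z\<^sub>e = - \<zeta>(e)\<close> and \<open>- w\<^sub>\<sigma>\<close> is the sum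
  of \<open>a\<close> over the four corners of \<open>\<sigma>\<close> (\<open>dual_normal_vec\<close>). Its coordinate at a quadrilateral type
  is the sum of the two feasibility expressions at the wedges which that quadrilateral separates, so it
  is non-negative; its coordinate at a triangle type \<open>p\<close> is at most \<open>2 a(p)\<close>. On the
  Kang-Rubinstein vectors, \<open>\<chi>\<^sup>*\<close> is \<open>1\<close> at \<open>W\<^sub>\<sigma>\<close>, \<open>2\<close> at \<open>W\<^sub>e\<close> for an interior edge and \<open>1\<close> at \<open>W\<^sub>e\<close> for a
  boundary edge (\<open>chi_star_W_combination\<close>), which are the constants of the area and curvature
  equations up to the factor \<open>\<pi>\<close>. As \<open>A \<ge> 0\<close>, the bound on the triangle coordinates shows that
  \<open>\<pi> (\<chi>\<^bsup>(A,\<kappa>)\<^esup>(s) - \<chi>\<^sup>*(s))\<close> is at most the dual objective (\<open>chi_gap_dual_normal_vec_le\<close>), so the hypotheses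
  on \<open>\<chi>\<^sup>*\<close> imply the conditions of duality. In the positive case the weak inequality is also needed
  when all quadrilateral coordinates vanish; it follows from the strict one by a limit, since
  subtracting small multiples of all \<open>W\<^sub>\<sigma>\<close> makes the quadrilateral coordinates positive
  (\<open>chi_star_le_of_strict\<close>).

  Two facts about the triangulation enter. The value of \<open>\<chi>\<^sup>*\<close> at a boundary edge rests on the fact
  that exactly two unpaired faces, with multiplicity, contain a simplex edge of its class
  (\<open>sum_unpaired_faces_at\<close>). The value of \<open>\<chi>\<^bsup>(A,\<kappa>)\<^esup>\<close> at \<open>s\<close> can be
  computed from the given coefficients \<open>z\<^sub>e\<close> because \<open>s\<close> determines them, as is seen within each
  single tetrahedron (\<open>W_combination_edge_coeff_unique\<close>).
\<close>

section \<open>Solvability of linear systems in non-negative and in positive unknowns\<close>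

text \<open>
  The combinations form a convex cone that contains the generators, hence contain their hull.
\<close>
lemma convex_cone_hull_image_combination:
  fixes c :: "'j \<Rightarrow> 'b::real_vector"
  assumes "finite J" and "x \<in> convex_cone hull (c ` J)"
  obtains \<theta> where "\<forall>j\<in>J. 0 \<le> \<theta> j" and "x = (\<Sum>j\<in>J. \<theta> j *\<^sub>R c j)"
proof -
  define C where "C = {\<Sum>j\<in>J. \<theta> j *\<^sub>R c j | \<theta>. \<forall>j\<in>J. (0::real) \<le> \<theta> j}"
  have sub: "c ` J \<subseteq> C"
  proof
    fix y assume "y \<in> c ` J"
    then obtain i where i: "i \<in> J" "y = c i" by blast
    then have "y = (\<Sum>j\<in>J. (if j = i then 1 else 0) *\<^sub>R c j)"
      using \<open>finite J\<close> by (simp add: if_distrib [of "\<lambda>r. r *\<^sub>R _"] cong: if_cong)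
    then show "y \<in> C"
      unfolding C_def by (intro CollectI exI[of _ "\<lambda>j. if j = i then 1 else 0"]) auto
  qed
  have "0 = (\<Sum>j\<in>J. 0 *\<^sub>R c j)" by simp
  then have zero: "0 \<in> C"
    unfolding C_def by (intro CollectI exI[of _ "\<lambda>j. 0"]) auto
  have add: "x + y \<in> C" if "x \<in> C" "y \<in> C" for x y
  proof -
    from that obtain \<theta> \<eta> where "x = (\<Sum>j\<in>J. \<theta> j *\<^sub>R c j)" "y = (\<Sum>j\<in>J. \<eta> j *\<^sub>R c j)"
      "\<forall>j\<in>J. 0 \<le> \<theta> j" "\<forall>j\<in>J. 0 \<le> \<eta> j" unfolding C_def by blast
    then show ?thesis
      unfolding C_def
      by (intro CollectI exI[of _ "\<lambda>j. \<theta> j + \<eta> j"]) (simp add: scaleR_add_left sum.distrib)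
  qed
  have scale: "r *\<^sub>R x \<in> C" if "x \<in> C" "0 \<le> r" for x r
  proof -
    from that obtain \<theta> where "x = (\<Sum>j\<in>J. \<theta> j *\<^sub>R c j)" "\<forall>j\<in>J. 0 \<le> \<theta> j"
      unfolding C_def by blast
    then show ?thesis
      unfolding C_def using that(2)
      by (intro CollectI exI[of _ "\<lambda>j. r * \<theta> j"]) (simp add: scaleR_sum_right)
  qed
  have "convex_cone C"
    unfolding convex_cone_iff using zero add scale by auto
  with sub have "convex_cone hull (c ` J) \<subseteq> C"
    by (rule hull_minimal)
  with assms(2) have "x \<in> C" by blast
  then obtain \<theta> where "x = (\<Sum>j\<in>J. \<theta> j *\<^sub>R c j)" "\<forall>j\<in>J. 0 \<le> \<theta> j"
    unfolding C_def by blast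
  then show ?thesis by (intro that) simp_all
qed

text \<open>
  Farkas' lemma: a finitely generated convex cone is closed, so a point \<open>b\<close> outside it is strictly
  separated from it by a hyperplane, whose normal vector would violate the hypothesis.
\<close>
lemma farkas_nonneg:
  fixes c :: "'j \<Rightarrow> 'b::euclidean_space"
  assumes "finite J"
    and dual: "\<And>y. (\<forall>j\<in>J. 0 \<le> y \<bullet> c j) \<Longrightarrow> 0 \<le> y \<bullet> b"
  obtains \<theta> where "\<forall>j\<in>J. 0 \<le> \<theta> j" and "(\<Sum>j\<in>J. \<theta> j *\<^sub>R c j) = b"
proof -
  let ?C = "convex_cone hull (c ` J)"
  have "b \<in> ?C"
  proof (rule ccontr)
    assume "b \<notin> ?C"
    moreover have "convex ?C" "closed ?C"
      using \<open>finite J\<close>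
      by (simp_all add: convex_convex_cone_hull closed_convex_cone_hull)
    ultimately have "\<exists>y r. y \<bullet> b < r \<and> (\<forall>x\<in>?C. r < y \<bullet> x)"
      by (intro separating_hyperplane_closed_point)
    then obtain y r where yr: "y \<bullet> b < r" "\<And>x. x \<in> ?C \<Longrightarrow> r < y \<bullet> x"
      by auto
    have "r < 0"
      using yr(2) [OF convex_cone_hull_contains_0] by simp
    have "0 \<le> y \<bullet> c j" if "j \<in> J" for j
    proof (rule ccontr)
      assume neg: "\<not> 0 \<le> y \<bullet> c j"
      have "(r / (y \<bullet> c j)) *\<^sub>R c j \<in> ?C"
        using that neg \<open>r < 0\<close>
        by (intro convex_cone_hull_mul hull_inc imageI divide_nonpos_nonpos) auto
      from yr(2) [OF this] neg show False by simp
    qed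
    then have "0 \<le> y \<bullet> b" by (intro dual ballI)
    with yr(1) \<open>r < 0\<close> show False by simp
  qed
  with \<open>finite J\<close> obtain \<theta> where "\<forall>j\<in>J. 0 \<le> \<theta> j" "b = (\<Sum>j\<in>J. \<theta> j *\<^sub>R c j)"
    by (rule convex_cone_hull_image_combination)
  then show ?thesis by (intro that) simp_all
qed

text \<open>
  The strict hypothesis makes minus the sum of the generators a point of the cone generated by all
  \<open>c j\<close> together with \<open>- b\<close>. Such a representation says that some combination with all coefficients
  at least \<open>1\<close> equals a non-negative multiple of \<open>b\<close>; adding a non-negative solution makes this
  multiple positive, and rescaling finishes the argument.
\<close>
lemma farkas_pos:
  fixes c :: "'j \<Rightarrow> 'b::euclidean_space"
  assumes "finite J"
    and weak: "\<And>y. (\<forall>j\<in>J. 0 \<le> y \<bullet> c j) \<Longrightarrow> 0 \<le> y \<bullet> b"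
    and strict: "\<And>y. (\<forall>j\<in>J. 0 \<le> y \<bullet> c j) \<Longrightarrow> (\<exists>j\<in>J. 0 < y \<bullet> c j) \<Longrightarrow> 0 < y \<bullet> b"
  obtains \<theta> where "\<forall>j\<in>J. 0 < \<theta> j" and "(\<Sum>j\<in>J. \<theta> j *\<^sub>R c j) = b"
proof -
  obtain \<theta>0 where \<theta>0: "\<forall>j\<in>J. 0 \<le> \<theta>0 j" "(\<Sum>j\<in>J. \<theta>0 j *\<^sub>R c j) = b"
    by (rule farkas_nonneg [OF \<open>finite J\<close> weak])
  (* The extra index None carries the generator - b. *)
  define d where "d = (\<lambda>k. case k of None \<Rightarrow> - b | Some j \<Rightarrow> c j)"
  let ?J = "insert None (Some ` J)"
  have "0 \<le> y \<bullet> (- (\<Sum>j\<in>J. c j))" if "\<forall>k\<in>?J. 0 \<le> y \<bullet> d k" for y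
  proof -
    from that have "\<forall>j\<in>J. 0 \<le> y \<bullet> c j" and "y \<bullet> b \<le> 0"
      by (auto simp: d_def)
    with strict [of y] have "\<forall>j\<in>J. y \<bullet> c j = 0"
      by (metis less_eq_real_def not_le)
    then show ?thesis by (simp add: inner_sum_right)
  qed
  moreover have "finite ?J" using \<open>finite J\<close> by simp
  ultimately obtain \<eta> where \<eta>: "\<forall>k\<in>?J. 0 \<le> \<eta> k"
      "(\<Sum>k\<in>?J. \<eta> k *\<^sub>R d k) = - (\<Sum>j\<in>J. c j)"
    using farkas_nonneg [of ?J d "- (\<Sum>j\<in>J. c j)"] by metis
  let ?r = "\<eta> None"
  have "(\<Sum>k\<in>?J. \<eta> k *\<^sub>R d k) = (\<Sum>j\<in>J. \<eta> (Some j) *\<^sub>R c j) - ?r *\<^sub>R b"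
    using \<open>finite J\<close> by (simp add: d_def sum.reindex)
  with \<eta>(2) have "(\<Sum>j\<in>J. \<eta> (Some j) *\<^sub>R c j) + (\<Sum>j\<in>J. c j) = ?r *\<^sub>R b"
    by (simp add: algebra_simps)
  with \<theta>0(2) have sum: "(\<Sum>j\<in>J. (\<eta> (Some j) + 1 + \<theta>0 j) *\<^sub>R c j) = (?r + 1) *\<^sub>R b"
    by (simp add: scaleR_add_left sum.distrib)
  have r: "0 < ?r + 1"
    using \<eta>(1) by (simp add: add_nonneg_pos)
  show ?thesis
  proof
    show "\<forall>j\<in>J. 0 < (\<eta> (Some j) + 1 + \<theta>0 j) / (?r + 1)"
      using \<eta>(1) \<theta>0(1) r by (auto intro!: divide_pos_pos add_pos_nonneg [OF add_nonneg_pos])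
    have "(\<Sum>j\<in>J. ((\<eta> (Some j) + 1 + \<theta>0 j) / (?r + 1)) *\<^sub>R c j) =
        (1 / (?r + 1)) *\<^sub>R (\<Sum>j\<in>J. (\<eta> (Some j) + 1 + \<theta>0 j) *\<^sub>R c j)"
      by (simp add: scaleR_sum_right)
    then show "(\<Sum>j\<in>J. ((\<eta> (Some j) + 1 + \<theta>0 j) / (?r + 1)) *\<^sub>R c j) = b"
      unfolding sum using r by simp
  qed
qed

section \<open>The combinatorics of one tetrahedron\<close>

lemma card_Compl_4: "card (- S) = 4 - card S" for S :: "4 set"
  by (simp add: Compl_eq_Diff_UNIV card_Diff_subset)

lemma simplex_edges_eq: "simplex_edges = {{1,2}, {1,3}, {1,4}, {2,3}, {2,4}, {3,4}}"
proof (intro equalityI subsetI)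
  fix e assume "e \<in> simplex_edges"
  then obtain u v where "e = {u, v}" "u \<noteq> v"
    by (auto simp: simplex_edges_def card_2_iff)
  then show "e \<in> {{1,2}, {1,3}, {1,4}, {2,3}, {2,4}, {3,4}}"
    using exhaust_4 [of u] exhaust_4 [of v] by (elim disjE) (simp_all add: insert_commute)
qed (auto simp: simplex_edges_def)

lemma sum_simplex_edges:
  "sum f simplex_edges = f {1,2} + f {1,3} + f {1,4} + f {2,3} + f {2,4} + (f {3,4} :: real)"
proof -
  have "distinct [{1,2}, {1,3}, {1,4}, {2,3}, {2,4}, {3,4::4}]"
    by (simp add: doubleton_eq_iff)
  then have "sum f (set [{1,2}, {1,3}, {1,4}, {2,3}, {2,4}, {3,4::4}]) =
      sum_list (map f [{1,2}, {1,3}, {1,4}, {2,3}, {2,4}, {3,4::4}])"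
    by (rule sum.distinct_set_conv_list)
  then show ?thesis by (simp add: simplex_edges_eq add.assoc)
qed

lemma simplex_faces_eq: "simplex_faces = range (\<lambda>v. - {v})"
proof (intro equalityI subsetI)
  fix F assume "F \<in> simplex_faces"
  then have "card (- F) = 1"
    unfolding simplex_faces_def by (simp add: card_Compl_4)
  then obtain v where "- F = {v}" by (meson card_1_singletonE)
  then have "F = - {v}" by blast
  then show "F \<in> range (\<lambda>v. - {v})" by blast
qed (auto simp: simplex_faces_def card_Compl_4)

lemma sum_simplex_faces: "sum f simplex_faces = (\<Sum>v\<in>UNIV. f (- {v}))"
  unfolding simplex_faces_eq by (subst sum.reindex) (auto simp: inj_on_def)

lemma Compl_doubletons_4:
  "- {1,2} = {3,4::4}" "- {1,3} = {2,4::4}" "- {1,4} = {2,3::4}"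
  "- {2,3} = {1,4::4}" "- {2,4} = {1,3::4}" "- {3,4} = {1,2::4}"
  unfolding Compl_eq_Diff_UNIV UNIV_4 by (simp_all add: insert_Diff_if)

lemma range_quad_sides:
  "range quad_sides = {{{1,2}, {3,4}}, {{1,3}, {2,4}}, {{1,4}, {2,3}}}"
proof -
  have "range quad_sides = {{S, - S} | S. S \<in> simplex_edges}"
    by (rule type_definition.Rep_range [OF type_definition_quad])
  also have "\<dots> = (\<lambda>S. {S, - S}) ` simplex_edges"
    by (rule Setcompr_eq_image)
  also have "\<dots> = {{{1,2}, {3,4}}, {{1,3}, {2,4}}, {{1,4}, {2,3}}}"
    unfolding simplex_edges_eq image_insert image_empty Compl_doubletons_4
    by (simp add: insert_commute)
  finally show ?thesis .
qed

lemma sum_quads: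
  "(\<Sum>q\<in>UNIV. f (quad_sides q)) =
    f {{1,2}, {3,4}} + f {{1,3}, {2,4}} + (f {{1,4}, {2,3}} :: real)"
proof -
  have "(\<Sum>q\<in>UNIV. f (quad_sides q)) = sum f (range quad_sides)"
    by (subst sum.reindex) (simp_all add: inj_def quad_sides_inject)
  moreover have "distinct [{{1,2}, {3,4}}, {{1,3}, {2,4}}, {{1,4}, {2,3::4}}]"
    by (simp add: doubleton_eq_iff)
  ultimately show ?thesis
    by (simp add: range_quad_sides add.assoc)
qed

lemma meets_edge_triangle:
  assumes "e \<in> simplex_edges"
  shows "meets_edge (triangle_sides v) e \<longleftrightarrow> v \<in> e"
  using assms by (auto simp: meets_edge_def triangle_sides_def simplex_edges_def card_2_iff)

lemma quad_sidesE:
  obtains S where "S \<in> simplex_edges" and "- S \<in> simplex_edges" and "quad_sides q = {S, - S}"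
proof -
  obtain S where S: "S \<in> simplex_edges" "quad_sides q = {S, - S}"
    using quad_sides [of q] by blast
  moreover have "- S \<in> simplex_edges"
    using S(1) by (simp add: simplex_edges_def card_Compl_4)
  ultimately show ?thesis by (rule_tac that)
qed

lemma meets_edge_quad:
  assumes "e \<in> simplex_edges"
  shows "meets_edge (quad_sides q) e \<longleftrightarrow> e \<notin> quad_sides q"
proof -
  obtain S where S: "S \<in> simplex_edges" "- S \<in> simplex_edges" "quad_sides q = {S, - S}"
    by (rule quad_sidesE)
  have sub: "e \<subseteq> T \<longleftrightarrow> e = T" if "T \<in> simplex_edges" for T
    using that assms card_subset_eq [of T e] by (auto simp: simplex_edges_def)
  have "meets_edge (quad_sides q) e \<longleftrightarrow> \<not> e \<subseteq> S \<and> \<not> e \<subseteq> - S"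
    unfolding meets_edge_def S(3) by blast
  then show ?thesis
    using S(3) by (simp add: sub S(1,2))
qed

lemma triangle_meets_face_in_arc:
  assumes "F \<in> simplex_faces"
  shows "meets_face_in_arc (triangle_sides p) F v \<longleftrightarrow> v \<in> F \<and> p = v"
proof -
  obtain u where F: "F = - {u}" using assms by (auto simp: simplex_faces_eq)
  have "- {p} \<inter> F \<noteq> {v}"
  proof
    assume "- {p} \<inter> F = {v}"
    moreover have "- {p, u} = - {p} \<inter> F" unfolding F by auto
    ultimately have "card (- {p, u}) = 1" by simp
    moreover have "card {p, u} \<le> 2" by (cases "p = u") simp_all
    ultimately show False unfolding card_Compl_4 by linarith
  qed
  moreover have "{p} \<inter> F = {v} \<longleftrightarrow> v \<in> F \<and> p = v"
    by (cases "p \<in> F") auto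
  ultimately show ?thesis unfolding meets_face_in_arc_def triangle_sides_def by blast
qed

lemma quad_meets_face_in_arcE:
  assumes "F \<in> simplex_faces" and "meets_face_in_arc (quad_sides q) F v"
  obtains u where "F = - {u}" and "u \<noteq> v" and "quad_sides q = {{u, v}, - {u, v}}"
proof -
  obtain u where F: "F = - {u}" using assms(1) by (auto simp: simplex_faces_eq)
  obtain S where S: "S \<in> quad_sides q" "S \<inter> F = {v}"
    using assms(2) by (auto simp: meets_face_in_arc_def)
  obtain T where T: "T \<in> simplex_edges" "- T \<in> simplex_edges" "quad_sides q = {T, - T}"
    by (rule quad_sidesE)
  have "S \<in> simplex_edges" and sides: "quad_sides q = {S, - S}"
    using S(1) T by auto
  then have "card S = 2" by (simp add: simplex_edges_def)
  have "S \<subseteq> {u, v}" "u \<noteq> v" using S(2) F by auto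
  with \<open>card S = 2\<close> have "S = {u, v}" by (intro card_subset_eq) auto
  then show ?thesis using F \<open>u \<noteq> v\<close> sides by (intro that) simp_all
qed

lemma quad_meets_every_face:
  assumes "F \<in> simplex_faces"
  shows "\<exists>v. meets_face_in_arc (quad_sides q) F v"
proof -
  obtain u where F: "F = - {u}" using assms by (auto simp: simplex_faces_eq)
  obtain T where T: "T \<in> simplex_edges" "- T \<in> simplex_edges" "quad_sides q = {T, - T}"
    by (rule quad_sidesE)
  obtain S where S: "S \<in> quad_sides q" "card S = 2" "u \<in> S"
    using T by (cases "u \<in> T") (auto simp: simplex_edges_def)
  then obtain v where "S = {u, v}" "u \<noteq> v" by (metis card_2_iff doubleton_eq_iff insertE singletonD)
  with S(1) F show ?thesis unfolding meets_face_in_arc_def by (intro exI[of _ v] bexI[of _ S]) auto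
qed

lemma obtain_three_quads:
  obtains q1 q2 q3 where "quad_sides q1 = {{1,2}, {3,4}}" and "quad_sides q2 = {{1,3}, {2,4}}"
    and "quad_sides q3 = {{1,4}, {2,3}}"
proof -
  have "{{1,2}, {3,4}} \<in> range quad_sides" "{{1,3}, {2,4}} \<in> range quad_sides"
    "{{1,4}, {2,3}} \<in> range quad_sides"
    unfolding range_quad_sides by simp_all
  then show ?thesis using that by (metis imageE)
qed

lemma sum_edges_at_vertex:
  fixes Z :: "4 set \<Rightarrow> real"
  shows "(\<Sum>e | e \<in> simplex_edges \<and> v \<in> e. Z e) = (\<Sum>e\<in>simplex_edges. if v \<in> e then Z e else 0)"
  by (simp add: sum.inter_filter)

section \<open>Edge classes and the boundary\<close>

text \<open>
  A connected multigraph on \<open>n\<close> vertices has at least \<open>n - 1\<close> edges. The indices \<open>i\<close> are the edges,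
  with endpoints \<open>s i\<close> and \<open>t i\<close>, so that parallel edges and loops are allowed; the hypothesis
  expresses connectedness. A set of vertices is grown one vertex at a time along a crossing edge.
\<close>
lemma card_le_Suc_card_connecting:
  fixes s t :: "'i \<Rightarrow> 'v"
  assumes "finite V" and "finite I" and "V \<noteq> {}"
    and cross: "\<And>S. S \<subset> V \<Longrightarrow> S \<noteq> {} \<Longrightarrow>
      \<exists>i\<in>I. (s i \<in> S \<and> t i \<in> V - S) \<or> (t i \<in> S \<and> s i \<in> V - S)"
  shows "card V \<le> Suc (card I)"
proof -
  have "\<exists>S\<subseteq>V. card S = Suc k \<and> k \<le> card {i \<in> I. s i \<in> S \<and> t i \<in> S}" if "Suc k \<le> card V" for k
    using that
  proof (induction k)
    case 0
    from \<open>V \<noteq> {}\<close> obtain x where "x \<in> V" by blast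
    then show ?case by (intro exI[of _ "{x}"]) simp
  next
    case (Suc k)
    then obtain S where S: "S \<subseteq> V" "card S = Suc k" "k \<le> card {i \<in> I. s i \<in> S \<and> t i \<in> S}"
      by auto
    have "S \<noteq> V" "S \<noteq> {}"
      using S(2) Suc.prems by auto
    with S(1) obtain i where i: "i \<in> I"
        "(s i \<in> S \<and> t i \<in> V - S) \<or> (t i \<in> S \<and> s i \<in> V - S)"
      using cross [of S] by blast
    then obtain y where y: "y \<in> V - S" "s i \<in> insert y S" "t i \<in> insert y S"
        "\<not> (s i \<in> S \<and> t i \<in> S)"
      by auto
    have "finite S" using S(1) \<open>finite V\<close> by (rule finite_subset)
    have "Suc k \<le> card (insert i {i \<in> I. s i \<in> S \<and> t i \<in> S})"
      using S(3) y(4) \<open>finite I\<close> by simp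
    also have "\<dots> \<le> card {j \<in> I. s j \<in> insert y S \<and> t j \<in> insert y S}"
      using \<open>finite I\<close> i(1) y by (intro card_mono) auto
    finally show ?case
      using S y(1) \<open>finite S\<close> by (intro exI[of _ "insert y S"]) auto
  qed
  moreover obtain k where k: "card V = Suc k"
    using \<open>finite V\<close> \<open>V \<noteq> {}\<close> by (metis card_gt_0_iff gr0_implies_Suc)
  ultimately obtain S where "k \<le> card {i \<in> I. s i \<in> S \<and> t i \<in> S}" by auto
  also have "\<dots> \<le> card I"
    using \<open>finite I\<close> by (intro card_mono) auto
  finally show ?thesis using k by simp
qed

lemma equiv_edge_equiv: "equiv UNIV (edge_equiv \<Phi>)"
  unfolding edge_equiv_def
  by (intro equivI refl_rtrancl sym_rtrancl trans_rtrancl sym_Un_converse) auto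

lemma pairing_facesD:
  assumes "triangulated_pseudo_manifold \<Phi>" and "((\<sigma>, F), (\<sigma>', F'), f) \<in> \<Phi>"
  shows "F \<in> simplex_faces" and "F' \<in> simplex_faces" and "(\<sigma>, F) \<noteq> (\<sigma>', F')" and "bij_betw f F F'"
  using assms unfolding triangulated_pseudo_manifold_def by fastforce+

lemma pairing_eqI:
  assumes "triangulated_pseudo_manifold \<Phi>" and "(\<tau>, \<delta>, f) \<in> \<Phi>" and "(\<tau>', \<delta>', f') \<in> \<Phi>"
    and "{\<tau>, \<delta>} \<inter> {\<tau>', \<delta>'} \<noteq> {}"
  shows "\<tau> = \<tau>' \<and> \<delta> = \<delta>' \<and> f = f'"
  using assms unfolding triangulated_pseudo_manifold_def by fast

lemma image_in_simplex_edges: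
  assumes "bij_betw f F F'" and "e \<subseteq> F" and "e \<in> simplex_edges"
  shows "f ` e \<in> simplex_edges"
proof -
  have "inj_on f e"
    using assms(1,2) by (meson bij_betw_imp_inj_on inj_on_subset)
  with assms(3) show ?thesis
    by (simp add: simplex_edges_def card_image)
qed

lemma edge_class_glued:
  assumes "((\<sigma>, F), (\<sigma>', F'), f) \<in> \<Phi>" and "e \<subseteq> F" and "e \<in> simplex_edges"
  shows "edge_class \<Phi> (\<sigma>, e) = edge_class \<Phi> (\<sigma>', f ` e)"
proof -
  have "((\<sigma>, e), (\<sigma>', f ` e)) \<in> edge_gluing \<Phi>"
    using assms unfolding edge_gluing_def by blast
  then have "((\<sigma>, e), (\<sigma>', f ` e)) \<in> edge_equiv \<Phi>"
    unfolding edge_equiv_def by blast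
  then show ?thesis
    unfolding edge_class_def by (rule equiv_class_eq [OF equiv_edge_equiv])
qed

lemma edge_class_subset:
  assumes "triangulated_pseudo_manifold \<Phi>" and "snd x \<in> simplex_edges"
  shows "edge_class \<Phi> x \<subseteq> UNIV \<times> simplex_edges"
proof
  fix y assume "y \<in> edge_class \<Phi> x"
  then have "(x, y) \<in> (edge_gluing \<Phi> \<union> (edge_gluing \<Phi>)\<inverse>)\<^sup>*"
    by (simp add: edge_class_def edge_equiv_def)
  then show "y \<in> UNIV \<times> simplex_edges"
  proof induction
    case base
    with assms(2) show ?case by (cases x) simp
  next
    case (step y z)
    then show ?case
      using image_in_simplex_edges pairing_facesD(4) [OF assms(1)]
      unfolding edge_gluing_def by blast
  qed
qed

lemma mem_edge_class_self: "x \<in> edge_class \<Phi> x"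
  by (simp add: edge_class_def edge_equiv_def)

lemma edge_class_eqI: "y \<in> edge_class \<Phi> x \<Longrightarrow> edge_class \<Phi> y = edge_class \<Phi> x"
  unfolding edge_class_def by (metis Image_singleton_iff equiv_class_eq equiv_edge_equiv)

lemma edges_eq_image: "edges \<Phi> = edge_class \<Phi> ` (UNIV \<times> simplex_edges)"
  unfolding edges_def edge_class_def quotient_def by blast

lemma edges_fiber:
  assumes "triangulated_pseudo_manifold \<Phi>" and "E \<in> edges \<Phi>"
  shows "{x \<in> UNIV \<times> simplex_edges. edge_class \<Phi> x = E} = E"
proof -
  obtain x where x: "x \<in> UNIV \<times> simplex_edges" "E = edge_class \<Phi> x"
    using assms(2) by (auto simp: edges_eq_image)
  then have "E \<subseteq> UNIV \<times> simplex_edges"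
    using edge_class_subset [OF assms(1), of x] by auto
  moreover have "y \<in> E \<longleftrightarrow> edge_class \<Phi> y = E" for y
    using x(2) edge_class_eqI mem_edge_class_self by metis
  ultimately show ?thesis by blast
qed

text \<open>
  The edge classes partition the set of all simplex edges.
\<close>
lemma sum_over_edges:
  fixes g :: "'t::finite cell \<Rightarrow> 'b::comm_monoid_add"
  assumes "triangulated_pseudo_manifold \<Phi>"
  shows "(\<Sum>E\<in>edges \<Phi>. \<Sum>x\<in>E. g x) = (\<Sum>x\<in>UNIV \<times> simplex_edges. g x)"
proof -
  have "(\<Sum>E\<in>edges \<Phi>. \<Sum>x\<in>E. g x) =
      (\<Sum>E\<in>edges \<Phi>. \<Sum>x\<in>{x \<in> UNIV \<times> simplex_edges. edge_class \<Phi> x = E}. g x)"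
    by (intro sum.cong refl) (simp add: edges_fiber [OF assms])
  also have "\<dots> = (\<Sum>x\<in>UNIV \<times> simplex_edges. g x)"
    by (intro sum.group) (simp_all add: edges_eq_image)
  finally show ?thesis .
qed

definition faces_at :: "4 set \<Rightarrow> 4 set set" where
  "faces_at e = {F \<in> simplex_faces. e \<subseteq> F}"

lemma card_faces_at:
  assumes "e \<in> simplex_edges"
  shows "card (faces_at e) = 2"
proof -
  have "faces_at e = (\<lambda>v. - {v}) ` (- e)"
    by (auto simp: faces_at_def simplex_faces_eq)
  moreover have "inj_on (\<lambda>v. - {v}) (- e)" by (auto simp: inj_on_def)
  ultimately have "card (faces_at e) = card (- e)" by (simp add: card_image)
  also have "\<dots> = 2" using assms by (simp add: card_Compl_4 simplex_edges_def)
  finally show ?thesis .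
qed

text \<open>
  Going around an edge of \<open>K\<close>, the tetrahedra form a cycle, or a chain with two free ends. In terms of
  counting: an edge of degree \<open>d\<close> has \<open>2d\<close> flags, which are pairs of a simplex edge in the class and a
  face containing it. Each of the \<open>m\<close> gluings at the edge uses up two flags, and the remaining
  \<open>2d - 2m\<close> flags have unpaired faces. The class is connected by the gluings, so \<open>m \<ge> d - 1\<close>, and the
  number of free flags is even and at most \<open>2\<close>.
\<close>
lemma sum_unpaired_faces_at:
  fixes \<Phi> :: "'t::finite pairing set"
  assumes K: "triangulated_pseudo_manifold \<Phi>" and E: "E \<in> edges \<Phi>"
  shows "(\<Sum>(\<sigma>, e)\<in>E. card {F \<in> faces_at e. (\<sigma>, F) \<in> unpaired_faces \<Phi>}) =
    (if boundary_edge \<Phi> E then 2 else 0)"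
proof -
  have mem_E: "x \<in> E \<longleftrightarrow> x \<in> UNIV \<times> simplex_edges \<and> edge_class \<Phi> x = E" for x
    using edges_fiber [OF K E] by blast
  have Esub: "E \<subseteq> UNIV \<times> simplex_edges"
    and Emem: "\<And>x y. x \<in> E \<Longrightarrow> edge_class \<Phi> x = edge_class \<Phi> y \<Longrightarrow> y \<in> UNIV \<times> simplex_edges \<Longrightarrow> y \<in> E"
    using mem_E by (blast, metis)
  define flags where "flags = (SIGMA x:E. faces_at (snd x))"
  define free where "free = (SIGMA x:E. {F \<in> faces_at (snd x). (fst x, F) \<in> unpaired_faces \<Phi>})"
  (* An index is a pairing together with a simplex edge of its source face that lies in E. It glues
     the flag s i to the flag t i. *)
  define I where "I = {(\<phi>, e). \<phi> \<in> \<Phi> \<and> e \<in> simplex_edges \<and> e \<subseteq> snd (fst \<phi>) \<and> (fst (fst \<phi>), e) \<in> E}"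
  define s :: "'t pairing \<times> 4 set \<Rightarrow> 't cell \<times> 4 set"
    where "s = (\<lambda>((\<tau>, \<delta>, f), e). ((fst \<tau>, e), snd \<tau>))"
  define t :: "'t pairing \<times> 4 set \<Rightarrow> 't cell \<times> 4 set"
    where "t = (\<lambda>((\<tau>, \<delta>, f), e). ((fst \<delta>, f ` e), snd \<delta>))"
  have face: "snd \<tau> \<in> simplex_faces" "snd \<delta> \<in> simplex_faces" "\<tau> \<noteq> \<delta>" "bij_betw f (snd \<tau>) (snd \<delta>)"
    if "(\<tau>, \<delta>, f) \<in> \<Phi>" for \<tau> \<delta> f
    using K that unfolding triangulated_pseudo_manifold_def by fastforce+
  have glued: "(\<sigma>', f ` e) \<in> E \<longleftrightarrow> (\<sigma>, e) \<in> E"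
    if "((\<sigma>, F), (\<sigma>', F'), f) \<in> \<Phi>" "e \<in> simplex_edges" "e \<subseteq> F" for \<sigma> F \<sigma>' F' f e
    using Emem edge_class_glued [OF that(1,3,2)] that(2)
      image_in_simplex_edges [OF pairing_facesD(4) [OF K that(1)] that(3,2)]
    by (metis SigmaI UNIV_I)
  have inj_s: "inj_on s I"
  proof (rule inj_onI)
    fix i j assume ij: "i \<in> I" "j \<in> I" "s i = s j"
    obtain \<tau> \<delta> f e \<tau>' \<delta>' f' e' where i: "i = ((\<tau>, \<delta>, f), e)" and j: "j = ((\<tau>', \<delta>', f'), e')"
      by (metis surj_pair)
    have "(\<tau>, \<delta>, f) \<in> \<Phi>" "(\<tau>', \<delta>', f') \<in> \<Phi>" "\<tau> = \<tau>'" and e: "e = e'"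
      using ij by (auto simp: i j I_def s_def prod_eq_iff)
    then have "\<tau> = \<tau>' \<and> \<delta> = \<delta>' \<and> f = f'"
      by (intro pairing_eqI [OF K]) auto
    with e show "i = j" by (simp add: i j)
  qed
  have inj_t: "inj_on t I"
  proof (rule inj_onI)
    fix i j assume ij: "i \<in> I" "j \<in> I" "t i = t j"
    obtain \<tau> \<delta> f e \<tau>' \<delta>' f' e' where i: "i = ((\<tau>, \<delta>, f), e)" and j: "j = ((\<tau>', \<delta>', f'), e')"
      by (metis surj_pair)
    have m: "(\<tau>, \<delta>, f) \<in> \<Phi>" "(\<tau>', \<delta>', f') \<in> \<Phi>" "e \<subseteq> snd \<tau>" "e' \<subseteq> snd \<tau>'"
      and eq: "\<delta> = \<delta>'" "f ` e = f' ` e'"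
      using ij by (auto simp: i j I_def t_def prod_eq_iff)
    from m(1,2) eq(1) have *: "\<tau> = \<tau>' \<and> \<delta> = \<delta>' \<and> f = f'"
      by (intro pairing_eqI [OF K]) auto
    with face(4) [OF m(1)] m(3,4) eq(2) have "e = e'"
      by (metis bij_betw_imp_inj_on inj_on_image_eq_iff)
    with * show "i = j" by (simp add: i j)
  qed
  have disj: "s ` I \<inter> t ` I = {}"
  proof (rule ccontr)
    assume "s ` I \<inter> t ` I \<noteq> {}"
    then obtain i j where ij: "i \<in> I" "j \<in> I" "s i = t j"
      unfolding disjoint_iff by (metis imageE)
    obtain \<tau> \<delta> f e \<tau>' \<delta>' f' e' where i: "i = ((\<tau>, \<delta>, f), e)" and j: "j = ((\<tau>', \<delta>', f'), e')"
      by (metis surj_pair)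
    have m: "(\<tau>, \<delta>, f) \<in> \<Phi>" "(\<tau>', \<delta>', f') \<in> \<Phi>" and eq: "\<tau> = \<delta>'"
      using ij by (auto simp: i j I_def s_def t_def prod_eq_iff)
    then have "\<tau> = \<tau>' \<and> \<delta> = \<delta>' \<and> f = f'"
      by (intro pairing_eqI [OF K]) auto
    with face(3) [OF m(1)] eq show False by simp
  qed
  have "flags = (s ` I \<union> t ` I) \<union> free"
  proof (intro equalityI subsetI)
    fix z assume z: "z \<in> flags"
    obtain \<sigma> e F where zeq: "z = ((\<sigma>, e), F)" by (metis surj_pair)
    from z have zE: "(\<sigma>, e) \<in> E" "F \<in> simplex_faces" "e \<subseteq> F"
      by (auto simp: flags_def zeq faces_at_def)
    then have e: "e \<in> simplex_edges" using Esub by auto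
    (* A flag is free, or its face is the source or the target of a pairing. *)
    consider "z \<in> free" | \<delta> f where "((\<sigma>, F), \<delta>, f) \<in> \<Phi>" | \<tau> f where "(\<tau>, (\<sigma>, F), f) \<in> \<Phi>"
      using zE by (fastforce simp: free_def zeq faces_at_def unpaired_faces_def)
    then show "z \<in> (s ` I \<union> t ` I) \<union> free"
    proof cases
      case (2 \<delta> f)
      then have "(((\<sigma>, F), \<delta>, f), e) \<in> I"
        using e zE by (simp add: I_def)
      then have "s (((\<sigma>, F), \<delta>, f), e) \<in> s ` I" by (rule imageI)
      then show ?thesis by (simp add: s_def zeq)
    next
      case (3 \<tau> f)
      obtain \<sigma>0 F0 where \<tau>: "\<tau> = (\<sigma>0, F0)" by (metis surj_pair)
      (* The simplex edge that the pairing carries to e. *)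
      define e0 where "e0 = {v \<in> F0. f v \<in> e}"
      have bij: "bij_betw f F0 F" using face(4) [OF 3] \<tau> by simp
      have fe0: "f ` e0 = e" and e0F0: "e0 \<subseteq> F0"
        using zE(3) bij_betw_imp_surj_on [OF bij] unfolding e0_def by auto
      have "card e0 = card e"
        using fe0 e0F0 bij by (metis bij_betw_imp_inj_on card_image inj_on_subset)
      with e have e0: "e0 \<in> simplex_edges" by (simp add: simplex_edges_def)
      have "(\<sigma>0, e0) \<in> E"
        using glued [OF 3 [unfolded \<tau>] e0 e0F0] zE(1) by (simp add: fe0)
      with e0 e0F0 3 have "((\<tau>, (\<sigma>, F), f), e0) \<in> I"
        by (simp add: I_def \<tau>)
      then have "t ((\<tau>, (\<sigma>, F), f), e0) \<in> t ` I" by (rule imageI)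
      then show ?thesis by (simp add: t_def zeq fe0)
    qed simp
  next
    fix z assume "z \<in> (s ` I \<union> t ` I) \<union> free"
    then consider "z \<in> free" | i where "i \<in> I" "z = s i" | i where "i \<in> I" "z = t i" by blast
    then show "z \<in> flags"
    proof cases
      case 1
      then show ?thesis by (auto simp: free_def flags_def)
    next
      case (2 i)
      then show ?thesis
        using face by (auto simp: I_def s_def flags_def faces_at_def)
    next
      case (3 i)
      then obtain \<sigma>0 F0 \<sigma> F f e where i: "i = (((\<sigma>0, F0), (\<sigma>, F), f), e)"
        by (metis surj_pair)
      with 3 have m: "((\<sigma>0, F0), (\<sigma>, F), f) \<in> \<Phi>" "e \<in> simplex_edges" "e \<subseteq> F0" "(\<sigma>0, e) \<in> E"
        by (auto simp: I_def)
      have "f ` e \<subseteq> F"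
        using m(3) bij_betw_imp_surj_on [OF pairing_facesD(4) [OF K m(1)]] by blast
      then show ?thesis
        using 3(2) glued [OF m(1,2,3)] m(4) pairing_facesD(2) [OF K m(1)]
        by (simp add: i t_def flags_def faces_at_def)
    qed
  qed
  moreover have "(s ` I \<union> t ` I) \<inter> free = {}"
    by (fastforce simp: I_def s_def t_def free_def unpaired_faces_def)
  ultimately have "card flags = card (s ` I \<union> t ` I) + card free"
    by (simp add: card_Un_disjoint)
  then have "card flags = 2 * card I + card free"
    by (simp add: card_Un_disjoint [OF _ _ disj] card_image inj_s inj_t)
  moreover have "card flags = 2 * card E"
  proof -
    have "card flags = (\<Sum>x\<in>E. card (faces_at (snd x)))"
      unfolding flags_def by (rule card_SigmaI) auto
    also have "\<dots> = (\<Sum>x\<in>E. 2)"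
      using Esub by (intro sum.cong) (auto simp: card_faces_at)
    finally show ?thesis by simp
  qed
  moreover have "card E \<le> Suc (card I)"
  proof (rule card_le_Suc_card_connecting [where s = "\<lambda>i. fst (s i)" and t = "\<lambda>i. fst (t i)"])
    show "E \<noteq> {}"
      using E mem_edge_class_self by (fastforce simp: edges_eq_image)
  next
    fix S assume S: "S \<subset> E" "S \<noteq> {}"
    show "\<exists>i\<in>I. fst (s i) \<in> S \<and> fst (t i) \<in> E - S \<or> fst (t i) \<in> S \<and> fst (s i) \<in> E - S"
    proof (rule ccontr)
      assume no_cross: "\<not> ?thesis"
      from S obtain x y where xy: "x \<in> S" "y \<in> E" "y \<notin> S" by blast
      have "edge_class \<Phi> x = edge_class \<Phi> y"
        using xy S(1) edges_fiber [OF K E] by blast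
      then have "(x, y) \<in> (edge_gluing \<Phi> \<union> (edge_gluing \<Phi>)\<inverse>)\<^sup>*"
        using mem_edge_class_self [of y \<Phi>] by (metis Image_singleton_iff edge_class_def edge_equiv_def)
      then have "y \<in> S"
      proof induction
        case base
        show ?case by (rule xy)
      next
        case (step y z)
        have both: "a \<in> S \<longleftrightarrow> b \<in> S" if ab: "(a, b) \<in> edge_gluing \<Phi>" and "a \<in> S \<or> b \<in> S" for a b
        proof -
          obtain \<sigma> e \<sigma>' F F' f where m: "a = (\<sigma>, e)" "b = (\<sigma>', f ` e)" "e \<in> simplex_edges"
              "((\<sigma>, F), (\<sigma>', F'), f) \<in> \<Phi>" "e \<subseteq> F"
            using ab unfolding edge_gluing_def by blast
          have abE: "a \<in> E" "b \<in> E"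
            using that(2) S(1) glued [OF m(4,3,5)] m(1,2) by auto
          define i where "i = (((\<sigma>, F), (\<sigma>', F'), f), e)"
          have "i \<in> I" "fst (s i) = a" "fst (t i) = b"
            using m abE(1) by (simp_all add: i_def I_def s_def t_def)
          with no_cross abE show ?thesis by blast
        qed
        from step show ?case using both by blast
      qed
      with xy show False by simp
    qed
  qed simp_all
  (* Together with the parity of the number of free flags, this decides between 0 and 2. *)
  moreover have "card free = 0 \<longleftrightarrow> \<not> boundary_edge \<Phi> E"
    by (fastforce simp: free_def boundary_edge_def faces_at_def unpaired_faces_def)
  ultimately have "card free = (if boundary_edge \<Phi> E then 2 else 0)"
    by presburger
  moreover have "card free = (\<Sum>(\<sigma>, e)\<in>E. card {F \<in> faces_at e. (\<sigma>, F) \<in> unpaired_faces \<Phi>})"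
    unfolding free_def by (subst card_SigmaI) (auto simp: case_prod_beta)
  ultimately show ?thesis by simp
qed

section \<open>Combinations of the Kang-Rubinstein vectors\<close>

definition W_combination ::
  "'t::finite pairing set \<Rightarrow> ('t \<Rightarrow> real) \<Rightarrow> ('t cell set \<Rightarrow> real) \<Rightarrow> 't normal_vec" where
  "W_combination \<Phi> w z = (\<Sum>\<sigma>\<in>UNIV. w \<sigma> *\<^sub>R W_tet \<sigma>) + (\<Sum>E\<in>edges \<Phi>. z E *\<^sub>R W_edge E)"

lemma sum_pair_indicator:
  fixes B :: "'b::finite set"
  shows "(\<Sum>b\<in>B. if a = a' \<and> c = b then 1 else (0::real)) = (if a' = a \<and> c \<in> B then 1 else 0)"
  by (cases "a = a'") auto

lemma W_tet_coords:
  "quad_coord (W_tet \<sigma>') (\<sigma>, q) = (if \<sigma>' = \<sigma> then - 1 else 0)"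
  "tri_coord (W_tet \<sigma>') (\<sigma>, v) = (if \<sigma>' = \<sigma> then 1 else 0)"
  unfolding W_tet_def vector_minus_component sum_component axis_def vec_lambda_beta
  by (simp_all add: sum_pair_indicator)

lemma W_edge_coords:
  fixes E :: "'t::finite cell set"
  assumes "E \<subseteq> UNIV \<times> simplex_edges"
  shows "quad_coord (W_edge E) (\<sigma>, q) = (\<Sum>x\<in>E. if fst x = \<sigma> \<and> snd x \<in> quad_sides q then - 1 else 0)"
    and "tri_coord (W_edge E) (\<sigma>, v) = (\<Sum>x\<in>E. if fst x = \<sigma> \<and> v \<in> snd x then 1 else 0)"
proof -
  show "quad_coord (W_edge E) (\<sigma>, q) = (\<Sum>x\<in>E. if fst x = \<sigma> \<and> snd x \<in> quad_sides q then - 1 else 0)"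
    unfolding W_edge_def sum_component
  proof (intro sum.cong refl)
    fix x assume "x \<in> E"
    with assms have "snd x \<in> simplex_edges" by auto
    then show "(case x of (\<sigma>, e') \<Rightarrow> (\<Sum>v | meets_edge (triangle_sides v) e'. tri_vec (\<sigma>, v)) -
        (\<Sum>q | \<not> meets_edge (quad_sides q) e'. quad_vec (\<sigma>, q))) $ Inl (\<sigma>, q) =
        (if fst x = \<sigma> \<and> snd x \<in> quad_sides q then - 1 else 0)"
      by (simp add: case_prod_beta axis_def meets_edge_quad sum_pair_indicator)
  qed
  show "tri_coord (W_edge E) (\<sigma>, v) = (\<Sum>x\<in>E. if fst x = \<sigma> \<and> v \<in> snd x then 1 else 0)"
    unfolding W_edge_def sum_component
  proof (intro sum.cong refl)
    fix x assume "x \<in> E"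
    with assms have "snd x \<in> simplex_edges" by auto
    then show "(case x of (\<sigma>, e') \<Rightarrow> (\<Sum>v | meets_edge (triangle_sides v) e'. tri_vec (\<sigma>, v)) -
        (\<Sum>q | \<not> meets_edge (quad_sides q) e'. quad_vec (\<sigma>, q))) $ Inr (\<sigma>, v) =
        (if fst x = \<sigma> \<and> v \<in> snd x then 1 else 0)"
      by (simp add: case_prod_beta axis_def meets_edge_triangle sum_pair_indicator)
  qed
qed

text \<open>
  Both sides count the edges of \<open>\<sigma>\<close> satisfying \<open>P\<close>, weighted by \<open>z\<close> at their classes. This turns the
  coordinates of a combination of the \<open>W\<^sub>e\<close>, a sum over edges of \<open>K\<close>, into sums over the six edges of
  one tetrahedron.
\<close>
lemma sum_edges_indicator:
  fixes \<Phi> :: "'t::finite pairing set" and P :: "4 set \<Rightarrow> bool" and c :: real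
  assumes "triangulated_pseudo_manifold \<Phi>"
  shows "(\<Sum>E\<in>edges \<Phi>. z E * (\<Sum>x\<in>E. if fst x = \<sigma> \<and> P (snd x) then c else 0)) =
    c * (\<Sum>e | e \<in> simplex_edges \<and> P e. z (edge_class \<Phi> (\<sigma>, e)))"
proof -
  have "(\<Sum>E\<in>edges \<Phi>. z E * (\<Sum>x\<in>E. if fst x = \<sigma> \<and> P (snd x) then c else 0)) =
      (\<Sum>E\<in>edges \<Phi>. \<Sum>x\<in>E. z (edge_class \<Phi> x) * (if fst x = \<sigma> \<and> P (snd x) then c else 0))"
    unfolding sum_distrib_left
  proof (intro sum.cong refl)
    fix E x assume "E \<in> edges \<Phi>" "x \<in> E"
    then have "edge_class \<Phi> x = E" using edges_fiber [OF assms] by blast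
    then show "z E * (if fst x = \<sigma> \<and> P (snd x) then c else 0) =
        z (edge_class \<Phi> x) * (if fst x = \<sigma> \<and> P (snd x) then c else 0)" by simp
  qed
  also have "\<dots> = (\<Sum>x\<in>UNIV \<times> simplex_edges.
      z (edge_class \<Phi> x) * (if fst x = \<sigma> \<and> P (snd x) then c else 0))"
    by (rule sum_over_edges [OF assms])
  also have "\<dots> = (\<Sum>x\<in>{\<sigma>} \<times> {e \<in> simplex_edges. P e}. z (edge_class \<Phi> x) * c)"
    by (rule sum.mono_neutral_cong_right) auto
  also have "\<dots> = c * (\<Sum>e | e \<in> simplex_edges \<and> P e. z (edge_class \<Phi> (\<sigma>, e)))"
    by (simp add: sum.cartesian_product' sum_distrib_left mult.commute)
  finally show ?thesis .
qed

lemma W_combination_coords: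
  assumes "triangulated_pseudo_manifold \<Phi>"
  shows "quad_coord (W_combination \<Phi> w z) (\<sigma>, q) =
      - w \<sigma> - (\<Sum>e\<in>quad_sides q. z (edge_class \<Phi> (\<sigma>, e)))"
    and "tri_coord (W_combination \<Phi> w z) (\<sigma>, v) =
      w \<sigma> + (\<Sum>e | e \<in> simplex_edges \<and> v \<in> e. z (edge_class \<Phi> (\<sigma>, e)))"
proof -
  have sub: "E \<subseteq> UNIV \<times> simplex_edges" if "E \<in> edges \<Phi>" for E
    using edges_fiber [OF assms that] by blast
  have "{e \<in> simplex_edges. e \<in> quad_sides q} = quad_sides q"
    by (rule quad_sidesE [of q]) auto
  then show "quad_coord (W_combination \<Phi> w z) (\<sigma>, q) =
      - w \<sigma> - (\<Sum>e\<in>quad_sides q. z (edge_class \<Phi> (\<sigma>, e)))"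
    using sum_edges_indicator [OF assms, of z \<sigma> "\<lambda>e. e \<in> quad_sides q" "- 1"]
    by (simp add: W_combination_def W_tet_coords W_edge_coords sub if_distrib cong: if_cong)
  show "tri_coord (W_combination \<Phi> w z) (\<sigma>, v) =
      w \<sigma> + (\<Sum>e | e \<in> simplex_edges \<and> v \<in> e. z (edge_class \<Phi> (\<sigma>, e)))"
    using sum_edges_indicator [OF assms, of z \<sigma> "\<lambda>e. v \<in> e" 1]
    by (simp add: W_combination_def W_tet_coords W_edge_coords sub if_distrib cong: if_cong)
qed

text \<open>
  The number on the right depends only on the values of \<open>Z\<close> at the three edges of the face \<open>F\<close>: the
  edge from \<open>v\<close> to the vertex off \<open>F\<close> cancels. This is why the vectors \<open>W\<^sub>e\<close> satisfy the matching equations.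
\<close>
lemma normal_arc_coordinate:
  fixes Z :: "4 set \<Rightarrow> real"
  assumes "F \<in> simplex_faces" and "v \<in> F" and "meets_face_in_arc (quad_sides q) F v"
  shows "(\<Sum>e | e \<in> simplex_edges \<and> v \<in> e. Z e) - (\<Sum>e\<in>quad_sides q. Z e) =
    (\<Sum>x\<in>F - {v}. Z {v, x}) - Z (F - {v})"
proof -
  obtain u where u: "F = - {u}" "u \<noteq> v" "quad_sides q = {{u, v}, - {u, v}}"
    using quad_meets_face_in_arcE [OF assms(1,3)] by metis
  have "{e. e \<in> simplex_edges \<and> v \<in> e} = (\<lambda>x. {v, x}) ` insert u (F - {v})"
  proof (intro equalityI subsetI)
    fix e assume "e \<in> {e. e \<in> simplex_edges \<and> v \<in> e}"
    then obtain x where "e = {v, x}" "x \<noteq> v"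
      by (auto simp: simplex_edges_def card_2_iff)
    then show "e \<in> (\<lambda>x. {v, x}) ` insert u (F - {v})"
      using u(1) by blast
  next
    fix e assume "e \<in> (\<lambda>x. {v, x}) ` insert u (F - {v})"
    then show "e \<in> {e. e \<in> simplex_edges \<and> v \<in> e}"
      using u(2) by (auto simp: simplex_edges_def)
  qed
  moreover have "inj_on (\<lambda>x. {v, x}) (insert u (F - {v}))"
    by (auto simp: inj_on_def doubleton_eq_iff)
  ultimately have "(\<Sum>e | e \<in> simplex_edges \<and> v \<in> e. Z e) = (\<Sum>x\<in>insert u (F - {v}). Z {v, x})"
    by (simp only: sum.reindex o_def)
  also have "\<dots> = Z {u, v} + (\<Sum>x\<in>F - {v}. Z {v, x})"
    using u(1) by (simp add: insert_commute)
  finally have "(\<Sum>e | e \<in> simplex_edges \<and> v \<in> e. Z e) = Z {u, v} + (\<Sum>x\<in>F - {v}. Z {v, x})" .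
  moreover have "(\<Sum>e\<in>quad_sides q. Z e) = Z {u, v} + Z (- {u, v})"
  proof -
    have "{u, v} \<noteq> - {u, v}" by (metis ComplD insertI1)
    then show ?thesis unfolding u(3) by simp
  qed
  moreover have "F - {v} = - {u, v}"
    unfolding u(1) by auto
  ultimately show ?thesis by simp
qed

lemma W_combination_in_solution_space:
  assumes "triangulated_pseudo_manifold \<Phi>"
  shows "W_combination \<Phi> w z \<in> solution_space \<Phi>"
proof -
  have "quad_coord (W_combination \<Phi> w z) (\<sigma>, q) + tri_coord (W_combination \<Phi> w z) (\<sigma>, p) =
      quad_coord (W_combination \<Phi> w z) (\<sigma>', q') + tri_coord (W_combination \<Phi> w z) (\<sigma>', p')"
    if \<phi>: "((\<sigma>, F), (\<sigma>', F'), f) \<in> \<Phi>" and v: "v \<in> F"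
      and arcs: "meets_face_in_arc (quad_sides q) F v" "meets_face_in_arc (triangle_sides p) F v"
        "meets_face_in_arc (quad_sides q') F' (f v)" "meets_face_in_arc (triangle_sides p') F' (f v)"
    for \<sigma> F \<sigma>' F' f v q p q' p'
  proof -
    note \<phi>D = pairing_facesD [OF assms \<phi>]
    have p: "p = v" and p': "p' = f v" and fv: "f v \<in> F'"
      using arcs triangle_meets_face_in_arc \<phi>D(1,2) by blast+
    have inj: "inj_on f F" and im: "f ` F = F'"
      using \<phi>D(4) by (auto simp: bij_betw_def)
    have rest: "F' - {f v} = f ` (F - {v})"
      using inj im v by (auto simp: inj_on_def)
    let ?Z = "\<lambda>e. z (edge_class \<Phi> (\<sigma>, e))" and ?Z' = "\<lambda>e. z (edge_class \<Phi> (\<sigma>', e))"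
    have Z: "?Z' (f ` e) = ?Z e" if "e \<subseteq> F" "e \<in> simplex_edges" for e
      using edge_class_glued [OF \<phi> that] by simp
    have "(\<Sum>x\<in>F' - {f v}. ?Z' {f v, x}) = (\<Sum>x\<in>F - {v}. ?Z' (f ` {v, x}))"
      unfolding rest using inj by (subst sum.reindex) (auto intro: inj_on_subset)
    also have "\<dots> = (\<Sum>x\<in>F - {v}. ?Z {v, x})"
      using v by (intro sum.cong refl Z) (auto simp: simplex_edges_def)
    finally have "(\<Sum>x\<in>F' - {f v}. ?Z' {f v, x}) = (\<Sum>x\<in>F - {v}. ?Z {v, x})" .
    moreover have "?Z' (F' - {f v}) = ?Z (F - {v})"
      unfolding rest using v \<phi>D(1) by (intro Z) (auto simp: simplex_edges_def simplex_faces_def)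
    ultimately show ?thesis
      using normal_arc_coordinate [OF \<phi>D(1) v arcs(1), of ?Z]
        normal_arc_coordinate [OF \<phi>D(2) fv arcs(3), of ?Z']
      by (simp add: W_combination_coords [OF assms] p p')
  qed
  then show ?thesis
    unfolding solution_space_def by blast
qed

text \<open>
  Inside one tetrahedron, the seven normal coordinates determine \<open>w \<sigma>\<close> and the six numbers \<open>z\<close> at
  its edges: comparing the sum of the four triangle coordinates with that of the three
  quadrilateral ones isolates \<open>w \<sigma>\<close>, and then the remaining equations are easily solved.
\<close>
lemma W_combination_edge_coeff_unique:
  assumes K: "triangulated_pseudo_manifold \<Phi>"
    and eq: "W_combination \<Phi> w z = W_combination \<Phi> w' z'" and "E \<in> edges \<Phi>"
  shows "z E = z' E"
proof -
  obtain \<sigma> e where e: "e \<in> simplex_edges" and E: "E = edge_class \<Phi> (\<sigma>, e)"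
    using \<open>E \<in> edges \<Phi>\<close> by (auto simp: edges_eq_image)
  define Z where "Z e = z (edge_class \<Phi> (\<sigma>, e)) - z' (edge_class \<Phi> (\<sigma>, e))" for e
  define \<omega> where "\<omega> = w \<sigma> - w' \<sigma>"
  have quad: "\<omega> + (\<Sum>e\<in>quad_sides q. Z e) = 0" for q
    using arg_cong [OF eq, of "\<lambda>s. quad_coord s (\<sigma>, q)"]
    by (simp add: W_combination_coords [OF K] Z_def \<omega>_def sum_subtractf)
  have tri: "\<omega> + (\<Sum>e\<in>simplex_edges. if v \<in> e then Z e else 0) = 0" for v
    using arg_cong [OF eq, of "\<lambda>s. tri_coord s (\<sigma>, v)"]
    by (simp add: W_combination_coords [OF K] Z_def \<omega>_def sum_subtractf
        sum_edges_at_vertex [symmetric])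
  obtain q1 q2 q3 where q: "quad_sides q1 = {{1,2}, {3,4}}" "quad_sides q2 = {{1,3}, {2,4}}"
      "quad_sides q3 = {{1,4}, {2,3}}"
    by (rule obtain_three_quads)
  have "\<omega> + Z {1,2} + Z {3,4} = 0" "\<omega> + Z {1,3} + Z {2,4} = 0" "\<omega> + Z {1,4} + Z {2,3} = 0"
    using quad [of q1] quad [of q2] quad [of q3] by (simp_all add: q doubleton_eq_iff)
  moreover have "\<omega> + Z {1,2} + Z {1,3} + Z {1,4} = 0" "\<omega> + Z {1,2} + Z {2,3} + Z {2,4} = 0"
    "\<omega> + Z {1,3} + Z {2,3} + Z {3,4} = 0" "\<omega> + Z {1,4} + Z {2,4} + Z {3,4} = 0"
    using tri [of 1] tri [of 2] tri [of 3] tri [of 4] by (simp_all add: sum_simplex_edges)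
  ultimately have "Z {1,2} = 0 \<and> Z {1,3} = 0 \<and> Z {1,4} = 0 \<and> Z {2,3} = 0 \<and> Z {2,4} = 0 \<and> Z {3,4} = 0"
    by argo
  with e have "Z e = 0" by (auto simp: simplex_edges_eq)
  then show ?thesis by (simp add: Z_def E)
qed

lemma chi_area_curvature_W_combination:
  assumes K: "triangulated_pseudo_manifold \<Phi>" and s: "s = W_combination \<Phi> w z"
  shows "chi_area_curvature \<Phi> A \<kappa> s =
    1 / (2 * pi) * ((\<Sum>p\<in>UNIV. tri_coord s p * A p) + (\<Sum>E\<in>edges \<Phi>. 2 * z E * \<kappa> E))"
  unfolding chi_area_curvature_def
proof (rule the_equality)
  show "\<exists>w' z'. s = (\<Sum>\<sigma>\<in>UNIV. w' \<sigma> *\<^sub>R W_tet \<sigma>) + (\<Sum>e\<in>edges \<Phi>. z' e *\<^sub>R W_edge e) \<and>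
      1 / (2 * pi) * ((\<Sum>p\<in>UNIV. tri_coord s p * A p) + (\<Sum>E\<in>edges \<Phi>. 2 * z E * \<kappa> E)) =
      1 / (2 * pi) * ((\<Sum>p\<in>UNIV. tri_coord s p * A p) + (\<Sum>e\<in>edges \<Phi>. 2 * z' e * \<kappa> e))"
    using s unfolding W_combination_def by blast
next
  fix r
  assume "\<exists>w z. s = (\<Sum>\<sigma>\<in>UNIV. w \<sigma> *\<^sub>R W_tet \<sigma>) + (\<Sum>e\<in>edges \<Phi>. z e *\<^sub>R W_edge e) \<and>
      r = 1 / (2 * pi) * ((\<Sum>p\<in>UNIV. tri_coord s p * A p) + (\<Sum>e\<in>edges \<Phi>. 2 * z e * \<kappa> e))"
  then obtain w' z' where "s = W_combination \<Phi> w' z'"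
    and r: "r = 1 / (2 * pi) * ((\<Sum>p\<in>UNIV. tri_coord s p * A p) + (\<Sum>e\<in>edges \<Phi>. 2 * z' e * \<kappa> e))"
    unfolding W_combination_def by blast
  then have "z' E = z E" if "E \<in> edges \<Phi>" for E
    using W_combination_edge_coeff_unique [OF K _ that] s by metis
  then show "r = 1 / (2 * pi) * ((\<Sum>p\<in>UNIV. tri_coord s p * A p) + (\<Sum>E\<in>edges \<Phi>. 2 * z E * \<kappa> E))"
    by (simp add: r)
qed

section \<open>The generalised Euler characteristic of a combination\<close>

text \<open>
  The contribution of one tetrahedron to \<open>\<chi>\<^sup>*\<close>, with \<open>D e\<close> standing for the inverse degree of the edge
  \<open>e\<close> and \<open>B u\<close> for the indicator that the face opposite to \<open>u\<close> is unpaired. The terms with \<open>D\<close> and \<open>B\<close>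
  cancel in the coefficient of \<open>w\<close>, where four triangles and three quadrilaterals leave
  \<open>- 4/2 + 3 = 1\<close>. In the coefficient of \<open>Z e\<close>, the triangles at the
  endpoints of \<open>e\<close> are compared with the quadrilateral disjoint from \<open>e\<close>: subtracting the four edges and
  the four faces that the latter meets, \<open>e\<close> remains twice and the two faces containing \<open>e\<close> remain once.
\<close>
lemma chi_star_tetrahedron:
  fixes w :: real and Z D :: "4 set \<Rightarrow> real" and B :: "4 \<Rightarrow> real"
  shows "(\<Sum>q\<in>UNIV. (- w - (\<Sum>e\<in>quad_sides q. Z e)) *
        (- (1/2) * (2 + (\<Sum>u\<in>UNIV. B u)) +
          (\<Sum>e\<in>simplex_edges. if e \<notin> quad_sides q then D e else 0))) +
      (\<Sum>v\<in>UNIV. (w + (\<Sum>e\<in>simplex_edges. if v \<in> e then Z e else 0)) *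
        (- (1/2) * (1 + (\<Sum>u\<in>UNIV. if u \<noteq> v then B u else 0)) +
          (\<Sum>e\<in>simplex_edges. if v \<in> e then D e else 0))) =
    w + (\<Sum>e\<in>simplex_edges. Z e * (2 * D e - (1/2) * (\<Sum>u\<in>UNIV. if u \<notin> e then B u else 0)))"
  unfolding sum_quads [of "\<lambda>S. (- w - (\<Sum>e\<in>S. Z e)) *
        (- (1/2) * (2 + (\<Sum>u\<in>UNIV. B u)) + (\<Sum>e\<in>simplex_edges. if e \<notin> S then D e else 0))"]
  by (simp add: sum_simplex_edges sum_4 doubleton_eq_iff) (simp add: field_simps)

lemma real_card_filter:
  "finite S \<Longrightarrow> real (card {x \<in> S. P x}) = (\<Sum>x\<in>S. if P x then 1 else 0)"
  by (simp add: sum.inter_filter [symmetric])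

lemma boundary_arcs_eq:
  fixes \<Phi> :: "'t pairing set"
  defines "B \<equiv> \<lambda>\<sigma> u. if (\<sigma>, - {u}) \<in> unpaired_faces \<Phi> then 1 else (0 :: real)"
  shows "real (boundary_arcs \<Phi> \<sigma> (quad_sides q)) = (\<Sum>u\<in>UNIV. B \<sigma> u)"
    and "real (boundary_arcs \<Phi> \<sigma> (triangle_sides v)) = (\<Sum>u\<in>UNIV. if u \<noteq> v then B \<sigma> u else 0)"
proof -
  have unp: "F \<in> simplex_faces" if "(\<sigma>, F) \<in> unpaired_faces \<Phi>" for F
    using that by (simp add: unpaired_faces_def)
  have q: "{F. (\<sigma>, F) \<in> unpaired_faces \<Phi> \<and> (\<exists>v. meets_face_in_arc (quad_sides q) F v)} =
      {F \<in> simplex_faces. (\<sigma>, F) \<in> unpaired_faces \<Phi>}"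
    using unp quad_meets_every_face by blast
  show "real (boundary_arcs \<Phi> \<sigma> (quad_sides q)) = (\<Sum>u\<in>UNIV. B \<sigma> u)"
    unfolding boundary_arcs_def q by (simp add: real_card_filter sum_simplex_faces B_def)
  have t: "{F. (\<sigma>, F) \<in> unpaired_faces \<Phi> \<and> (\<exists>x. meets_face_in_arc (triangle_sides v) F x)} =
      {F \<in> simplex_faces. v \<in> F \<and> (\<sigma>, F) \<in> unpaired_faces \<Phi>}"
    by (intro Collect_cong) (metis unp triangle_meets_face_in_arc)
  show "real (boundary_arcs \<Phi> \<sigma> (triangle_sides v)) = (\<Sum>u\<in>UNIV. if u \<noteq> v then B \<sigma> u else 0)"
    unfolding boundary_arcs_def t
    by (simp add: real_card_filter sum_simplex_faces B_def) (intro sum.cong; auto simp: B_def)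
qed

lemma inverse_degree_sum_eq:
  fixes \<Phi> :: "'t pairing set"
  defines "D \<equiv> \<lambda>\<sigma> e. 1 / real (edge_degree (edge_class \<Phi> (\<sigma>, e)))"
  shows "inverse_degree_sum \<Phi> \<sigma> (quad_sides q) =
      (\<Sum>e\<in>simplex_edges. if e \<notin> quad_sides q then D \<sigma> e else 0)"
    and "inverse_degree_sum \<Phi> \<sigma> (triangle_sides v) =
      (\<Sum>e\<in>simplex_edges. if v \<in> e then D \<sigma> e else 0)"
  unfolding inverse_degree_sum_def D_def
  by (simp_all add: sum.inter_filter [symmetric] meets_edge_quad meets_edge_triangle cong: conj_cong)

text \<open>
  Summing the local contributions over the class of an edge, the inverse degrees add up to \<open>1\<close>, and
  each of the two boundary faces at a boundary edge subtracts \<open>1/2\<close> from the value \<open>2\<close>.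
\<close>
lemma chi_star_W_combination:
  fixes \<Phi> :: "'t::finite pairing set"
  assumes K: "triangulated_pseudo_manifold \<Phi>"
  shows "chi_star \<Phi> (W_combination \<Phi> w z) =
    (\<Sum>\<sigma>\<in>UNIV. w \<sigma>) + (\<Sum>E\<in>edges \<Phi>. z E * (if boundary_edge \<Phi> E then 1 else 2))"
proof -
  define B :: "'t \<Rightarrow> 4 \<Rightarrow> real" where "B = (\<lambda>\<sigma> u. if (\<sigma>, - {u}) \<in> unpaired_faces \<Phi> then 1 else 0)"
  define D where "D = (\<lambda>\<sigma> e. 1 / real (edge_degree (edge_class \<Phi> (\<sigma>, e))))"
  define N where "N = (\<lambda>(\<sigma>, e). card {F \<in> faces_at e. (\<sigma>, F) \<in> unpaired_faces \<Phi>})"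
  have N: "(\<Sum>u\<in>UNIV. if u \<notin> e then B \<sigma> u else 0) = real (N (\<sigma>, e))" for \<sigma> e
  proof -
    have "{F \<in> faces_at e. (\<sigma>, F) \<in> unpaired_faces \<Phi>} =
        {F \<in> simplex_faces. e \<subseteq> F \<and> (\<sigma>, F) \<in> unpaired_faces \<Phi>}"
      by (auto simp: faces_at_def)
    then show ?thesis
      by (simp add: N_def real_card_filter sum_simplex_faces) (intro sum.cong; auto simp: B_def)
  qed
  have local_sum: "(\<Sum>q\<in>UNIV. quad_coord (W_combination \<Phi> w z) (\<sigma>, q) * chi_star_type \<Phi> (Inl (\<sigma>, q))) +
      (\<Sum>v\<in>UNIV. tri_coord (W_combination \<Phi> w z) (\<sigma>, v) * chi_star_type \<Phi> (Inr (\<sigma>, v))) =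
    w \<sigma> + (\<Sum>e\<in>simplex_edges. z (edge_class \<Phi> (\<sigma>, e)) * (2 * D \<sigma> e - (1/2) * real (N (\<sigma>, e))))" for \<sigma>
    using chi_star_tetrahedron [of "w \<sigma>" "\<lambda>e. z (edge_class \<Phi> (\<sigma>, e))" "B \<sigma>" "D \<sigma>"]
    unfolding N W_combination_coords [OF K] chi_star_type.simps boundary_arcs_eq inverse_degree_sum_eq
    by (simp only: B_def D_def sum.inter_filter finite)
  have "chi_star \<Phi> (W_combination \<Phi> w z) = (\<Sum>\<sigma>\<in>UNIV.
      (\<Sum>q\<in>UNIV. quad_coord (W_combination \<Phi> w z) (\<sigma>, q) * chi_star_type \<Phi> (Inl (\<sigma>, q))) +
      (\<Sum>v\<in>UNIV. tri_coord (W_combination \<Phi> w z) (\<sigma>, v) * chi_star_type \<Phi> (Inr (\<sigma>, v))))"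
    unfolding chi_star_def UNIV_Times_UNIV [symmetric] sum.cartesian_product' sum.distrib by simp
  also have "\<dots> = (\<Sum>\<sigma>\<in>UNIV. w \<sigma>) + (\<Sum>\<sigma>\<in>UNIV. \<Sum>e\<in>simplex_edges.
      z (edge_class \<Phi> (\<sigma>, e)) * (2 * D \<sigma> e - (1/2) * real (N (\<sigma>, e))))"
    unfolding local_sum sum.distrib ..
  also have "(\<Sum>\<sigma>\<in>UNIV. \<Sum>e\<in>simplex_edges.
      z (edge_class \<Phi> (\<sigma>, e)) * (2 * D \<sigma> e - (1/2) * real (N (\<sigma>, e)))) =
    (\<Sum>x\<in>UNIV \<times> simplex_edges. z (edge_class \<Phi> x) * (2 / real (card (edge_class \<Phi> x)) - (1/2) * real (N x)))"
    by (simp add: sum.cartesian_product' D_def edge_degree_def)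
  also have "\<dots> = (\<Sum>E\<in>edges \<Phi>. \<Sum>x\<in>E. z (edge_class \<Phi> x) * (2 / real (card (edge_class \<Phi> x)) - (1/2) * real (N x)))"
    by (rule sum_over_edges [OF K, symmetric])
  also have "\<dots> = (\<Sum>E\<in>edges \<Phi>. z E * (if boundary_edge \<Phi> E then 1 else 2))"
  proof (rule sum.cong [OF refl])
    fix E assume E: "E \<in> edges \<Phi>"
    have "E \<noteq> {}"
      using E mem_edge_class_self by (fastforce simp: edges_eq_image)
    have "(\<Sum>x\<in>E. z (edge_class \<Phi> x) * (2 / real (card (edge_class \<Phi> x)) - (1/2) * real (N x))) =
        (\<Sum>x\<in>E. z E * (2 / real (card E) - (1/2) * real (N x)))"
    proof (rule sum.cong [OF refl])
      fix x assume "x \<in> E"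
      then have "edge_class \<Phi> x = E" using edges_fiber [OF K E] by blast
      then show "z (edge_class \<Phi> x) * (2 / real (card (edge_class \<Phi> x)) - (1/2) * real (N x)) =
          z E * (2 / real (card E) - (1/2) * real (N x))" by simp
    qed
    also have "\<dots> = z E * (2 - (1/2) * real (\<Sum>x\<in>E. N x))"
      using \<open>E \<noteq> {}\<close> by (simp add: sum_distrib_left [symmetric] sum_subtractf sum_divide_distrib [symmetric])
    also have "(\<Sum>x\<in>E. N x) = (if boundary_edge \<Phi> E then 2 else 0)"
      unfolding N_def by (rule sum_unpaired_faces_at [OF K E])
    finally show "(\<Sum>x\<in>E. z (edge_class \<Phi> x) * (2 / real (card (edge_class \<Phi> x)) - (1/2) * real (N x))) =
        z E * (if boundary_edge \<Phi> E then 1 else 2)" by simp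
  qed
  finally show ?thesis .
qed

section \<open>Angle structures as solutions of a dual problem\<close>

text \<open>
  The column of a wedge in the linear system for the angles: the first component has a row for each
  triangle type, the second one a row for each edge class. Rows are indexed by all sets of cells,
  and those that are not edges of \<open>K\<close> vanish on both sides of the system.
\<close>
definition wedge_vec :: "'t::finite pairing set \<Rightarrow> 't cell \<Rightarrow> (real ^ ('t \<times> 4)) \<times> (real ^ ('t cell set))" where
  "wedge_vec \<Phi> x = (\<Sum>v\<in>snd x. axis (fst x, v) 1, axis (edge_class \<Phi> x) 1)"

definition area_curvature_vec ::
  "'t::finite pairing set \<Rightarrow> ('t \<times> 4 \<Rightarrow> real) \<Rightarrow> ('t cell set \<Rightarrow> real) \<Rightarrow>
    (real ^ ('t \<times> 4)) \<times> (real ^ ('t cell set))" where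
  "area_curvature_vec \<Phi> A \<kappa> =
    (\<chi> p. pi + A p,
     \<chi> E. if E \<in> edges \<Phi> then (if boundary_edge \<Phi> E then pi else 2 * pi) - \<kappa> E else 0)"

lemma has_area_curvatureI:
  fixes \<Phi> :: "'t::finite pairing set"
  assumes K: "triangulated_pseudo_manifold \<Phi>"
    and sol: "(\<Sum>x\<in>UNIV \<times> simplex_edges. \<theta> x *\<^sub>R wedge_vec \<Phi> x) = area_curvature_vec \<Phi> A \<kappa>"
  shows "has_area_curvature \<Phi> A \<kappa> \<theta>"
  unfolding has_area_curvature_def
proof (intro conjI allI ballI)
  fix p :: "'t \<times> 4"
  obtain \<sigma> v where p: "p = (\<sigma>, v)" by (metis surj_pair)
  have "pi + A p = (\<Sum>x\<in>UNIV \<times> simplex_edges. \<theta> x * (if fst x = \<sigma> \<and> v \<in> snd x then 1 else 0))"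
    using arg_cong [OF sol, of "\<lambda>y. fst y $ p"]
    by (simp add: fst_sum wedge_vec_def area_curvature_vec_def p axis_def sum_pair_indicator)
  also have "\<dots> = (\<Sum>x\<in>{\<sigma>} \<times> {e \<in> simplex_edges. v \<in> e}. \<theta> x)"
    by (rule sum.mono_neutral_cong_right) auto
  also have "\<dots> = (\<Sum>e | e \<in> simplex_edges \<and> meets_edge (triangle_sides v) e. \<theta> (\<sigma>, e))"
    by (simp add: sum.cartesian_product' meets_edge_triangle cong: conj_cong)
  finally show "tri_area \<theta> p = A p"
    by (simp add: tri_area_def p)
next
  fix E assume E: "E \<in> edges \<Phi>"
  have "(if boundary_edge \<Phi> E then pi else 2 * pi) - \<kappa> E =
      (\<Sum>x\<in>UNIV \<times> simplex_edges. \<theta> x * (if edge_class \<Phi> x = E then 1 else 0))"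
    using arg_cong [OF sol, of "\<lambda>y. snd y $ E"] E
    by (simp add: snd_sum wedge_vec_def area_curvature_vec_def axis_def eq_commute)
  also have "\<dots> = (\<Sum>x\<in>{x \<in> UNIV \<times> simplex_edges. edge_class \<Phi> x = E}. \<theta> x)"
    by (rule sum.mono_neutral_cong_right) auto
  also have "\<dots> = (\<Sum>x\<in>E. \<theta> x)"
    unfolding edges_fiber [OF K E] ..
  finally show "edge_curvature \<Phi> \<theta> E = \<kappa> E"
    by (simp add: edge_curvature_def)
qed

lemma inner_wedge_vec:
  "(a, \<zeta>) \<bullet> wedge_vec \<Phi> (\<sigma>, e) = (\<Sum>v\<in>e. a $ (\<sigma>, v)) + \<zeta> $ edge_class \<Phi> (\<sigma>, e)"
  by (simp add: wedge_vec_def inner_Pair inner_sum_right inner_axis)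

lemma inner_area_curvature_vec:
  fixes \<Phi> :: "'t::finite pairing set"
  shows "(a, \<zeta>) \<bullet> area_curvature_vec \<Phi> A \<kappa> = (\<Sum>p\<in>UNIV. a $ p * (pi + A p)) +
    (\<Sum>E\<in>edges \<Phi>. \<zeta> $ E * ((if boundary_edge \<Phi> E then pi else 2 * pi) - \<kappa> E))"
proof -
  have "(\<Sum>E\<in>UNIV. \<zeta> $ E * (if E \<in> edges \<Phi> then (if boundary_edge \<Phi> E then pi else 2 * pi) - \<kappa> E else 0)) =
      (\<Sum>E\<in>edges \<Phi>. \<zeta> $ E * ((if boundary_edge \<Phi> E then pi else 2 * pi) - \<kappa> E))"
    by (rule sum.mono_neutral_cong_right) auto
  then show ?thesis
    unfolding area_curvature_vec_def inner_Pair inner_vec_def by simp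
qed

text \<open>
  The normal surface vector that belongs to a dual variable. The coefficients at the tetrahedra are
  the largest ones for which feasibility still makes every quadrilateral coordinate non-negative.
\<close>
definition dual_normal_vec ::
  "'t::finite pairing set \<Rightarrow> (real ^ ('t \<times> 4)) \<times> (real ^ ('t cell set)) \<Rightarrow> 't normal_vec" where
  "dual_normal_vec \<Phi> y = W_combination \<Phi> (\<lambda>\<sigma>. - (\<Sum>v\<in>UNIV. fst y $ (\<sigma>, v))) (\<lambda>E. - (snd y $ E))"

text \<open>
  The two simplex edges that are the sides of \<open>q\<close> have together all four vertices as endpoints, so the
  corner terms add up to the coefficient of \<open>W\<^sub>\<sigma>\<close>.
\<close>
lemma quad_coord_dual_normal_vec:
  assumes "triangulated_pseudo_manifold \<Phi>"
  shows "quad_coord (dual_normal_vec \<Phi> y) (\<sigma>, q) = (\<Sum>e\<in>quad_sides q. y \<bullet> wedge_vec \<Phi> (\<sigma>, e))"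
proof -
  obtain a \<zeta> where y: "y = (a, \<zeta>)" by (metis surj_pair)
  obtain S where S: "quad_sides q = {S, - S}" by (rule quad_sidesE)
  have ne: "S \<noteq> - S" by blast
  have "(\<Sum>e\<in>quad_sides q. \<Sum>v\<in>e. a $ (\<sigma>, v)) = (\<Sum>v\<in>S. a $ (\<sigma>, v)) + (\<Sum>v\<in>- S. a $ (\<sigma>, v))"
    using ne by (simp add: S)
  also have "\<dots> = (\<Sum>v\<in>UNIV. a $ (\<sigma>, v))"
    by (subst sum.union_disjoint [symmetric]) simp_all
  finally show ?thesis
    by (simp add: dual_normal_vec_def W_combination_coords [OF assms] y inner_wedge_vec
        sum.distrib sum_negf)
qed

text \<open>
  Feasibility at the three edges containing the corner \<open>v\<close> bounds the edge terms by the corner terms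
  at their endpoints; in these, \<open>v\<close> is counted three times and every other corner once.
\<close>
lemma tri_coord_dual_normal_vec_le:
  assumes K: "triangulated_pseudo_manifold \<Phi>"
    and nonneg: "\<forall>x\<in>UNIV \<times> simplex_edges. 0 \<le> y \<bullet> wedge_vec \<Phi> x"
  shows "tri_coord (dual_normal_vec \<Phi> y) p \<le> 2 * fst y $ p"
proof -
  obtain a \<zeta> where y: "y = (a, \<zeta>)" by (metis surj_pair)
  obtain \<sigma> v where p: "p = (\<sigma>, v)" by (metis surj_pair)
  have "tri_coord (dual_normal_vec \<Phi> y) p =
      - (\<Sum>u\<in>UNIV. a $ (\<sigma>, u)) + (\<Sum>e | e \<in> simplex_edges \<and> v \<in> e. - (\<zeta> $ edge_class \<Phi> (\<sigma>, e)))"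
    by (simp add: dual_normal_vec_def W_combination_coords [OF K] y p)
  also have "(\<Sum>e | e \<in> simplex_edges \<and> v \<in> e. - (\<zeta> $ edge_class \<Phi> (\<sigma>, e))) \<le>
      (\<Sum>e | e \<in> simplex_edges \<and> v \<in> e. \<Sum>u\<in>e. a $ (\<sigma>, u))"
  proof (rule sum_mono)
    fix e assume "e \<in> {e. e \<in> simplex_edges \<and> v \<in> e}"
    with nonneg have "0 \<le> y \<bullet> wedge_vec \<Phi> (\<sigma>, e)" by simp
    then show "- (\<zeta> $ edge_class \<Phi> (\<sigma>, e)) \<le> (\<Sum>u\<in>e. a $ (\<sigma>, u))"
      by (simp add: y inner_wedge_vec)
  qed
  also have "(\<Sum>e | e \<in> simplex_edges \<and> v \<in> e. \<Sum>u\<in>e. a $ (\<sigma>, u)) =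
      2 * a $ (\<sigma>, v) + (\<Sum>u\<in>UNIV. a $ (\<sigma>, u))"
    unfolding sum_edges_at_vertex sum_simplex_edges sum_4
    using exhaust_4 [of v] by (elim disjE) simp_all
  finally show ?thesis by (simp add: y p)
qed

text \<open>
  As \<open>\<chi>\<^sup>*(W\<^sub>\<sigma>) = 1\<close> and the coefficient of \<open>W\<^sub>\<sigma>\<close> is minus the sum of the corner variables, \<open>- \<pi> \<chi>\<^sup>*\<close>
  weights each corner variable by \<open>\<pi>\<close>, and the edge variables by \<open>\<pi>\<close> or \<open>2\<pi>\<close>, exactly as the constants of
  the area and curvature equations do. The terms with \<open>\<kappa>\<close> agree as well. What is left to compare is
  half the triangle coordinates with the corner variables, both weighted by \<open>A\<close>.
\<close>
lemma chi_gap_dual_normal_vec_le: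
  assumes K: "triangulated_pseudo_manifold \<Phi>" and A: "\<forall>p. A p \<ge> 0"
    and nonneg: "\<forall>x\<in>UNIV \<times> simplex_edges. 0 \<le> y \<bullet> wedge_vec \<Phi> x"
  shows "pi * (chi_area_curvature \<Phi> A \<kappa> (dual_normal_vec \<Phi> y) - chi_star \<Phi> (dual_normal_vec \<Phi> y))
    \<le> y \<bullet> area_curvature_vec \<Phi> A \<kappa>"
proof -
  obtain a \<zeta> where y: "y = (a, \<zeta>)" by (metis surj_pair)
  define s where "s = dual_normal_vec \<Phi> y"
  define k where "k = (\<lambda>E. if boundary_edge \<Phi> E then 1 else (2 :: real))"
  have "2 * pi * chi_area_curvature \<Phi> A \<kappa> s =
      (\<Sum>p\<in>UNIV. tri_coord s p * A p) - 2 * (\<Sum>E\<in>edges \<Phi>. \<zeta> $ E * \<kappa> E)"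
    unfolding s_def dual_normal_vec_def chi_area_curvature_W_combination [OF K refl]
    by (simp add: y sum_negf sum_distrib_left mult.assoc)
  moreover have "(\<Sum>p\<in>UNIV. tri_coord s p * A p) \<le> (\<Sum>p\<in>UNIV. 2 * a $ p * A p)"
    using tri_coord_dual_normal_vec_le [OF K nonneg] A [rule_format]
    by (intro sum_mono mult_right_mono) (simp_all add: s_def y)
  moreover have "pi * chi_star \<Phi> s = pi * (- (\<Sum>p\<in>UNIV. a $ p) - (\<Sum>E\<in>edges \<Phi>. \<zeta> $ E * k E))"
  proof -
    have "(\<Sum>\<sigma>\<in>UNIV. \<Sum>v\<in>UNIV. a $ (\<sigma>, v)) = (\<Sum>p\<in>UNIV. a $ p)"
      unfolding UNIV_Times_UNIV [symmetric] sum.cartesian_product' by simp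
    then show ?thesis
      unfolding s_def dual_normal_vec_def chi_star_W_combination [OF K]
      by (simp add: y k_def sum_negf)
  qed
  moreover have "y \<bullet> area_curvature_vec \<Phi> A \<kappa> =
      pi * (\<Sum>p\<in>UNIV. a $ p) + (\<Sum>p\<in>UNIV. a $ p * A p) +
      pi * (\<Sum>E\<in>edges \<Phi>. \<zeta> $ E * k E) - (\<Sum>E\<in>edges \<Phi>. \<zeta> $ E * \<kappa> E)"
  proof -
    have "(\<Sum>E\<in>edges \<Phi>. \<zeta> $ E * ((if boundary_edge \<Phi> E then pi else 2 * pi) - \<kappa> E)) =
        (\<Sum>E\<in>edges \<Phi>. pi * (\<zeta> $ E * k E) - \<zeta> $ E * \<kappa> E)"
      by (intro sum.cong refl) (simp add: k_def algebra_simps)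
    then show ?thesis
      by (simp add: y inner_area_curvature_vec sum_subtractf sum.distrib sum_distrib_left algebra_simps)
  qed
  moreover have "(\<Sum>p\<in>UNIV. 2 * a $ p * A p) = 2 * (\<Sum>p\<in>UNIV. a $ p * A p)"
    by (simp add: sum_distrib_left mult.assoc)
  ultimately show ?thesis
    unfolding s_def [symmetric] by (simp add: algebra_simps)
qed

text \<open>
  Lowering all coefficients \<open>w \<sigma>\<close> by \<open>\<delta>\<close> raises the quadrilateral coordinates by \<open>\<delta>\<close>, so that the
  strict inequality becomes available. It changes \<open>\<chi>\<^sup>*\<close> by \<open>\<delta>\<close> times the number of tetrahedra, and it
  does not increase \<open>\<chi>\<^bsup>(A,\<kappa>)\<^esup>\<close> because \<open>A \<ge> 0\<close>.
\<close>
lemma chi_star_le_of_strict: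
  fixes \<Phi> :: "'t::finite pairing set"
  assumes K: "triangulated_pseudo_manifold \<Phi>" and A: "\<forall>p. A p \<ge> 0"
    and strict: "\<forall>s \<in> solution_space \<Phi>. (\<forall>q. quad_coord s q \<ge> 0) \<and> (\<exists>q. quad_coord s q > 0) \<longrightarrow>
      chi_star \<Phi> s < chi_area_curvature \<Phi> A \<kappa> s"
    and nonneg: "\<forall>q. quad_coord (W_combination \<Phi> w z) q \<ge> 0"
  shows "chi_star \<Phi> (W_combination \<Phi> w z) \<le> chi_area_curvature \<Phi> A \<kappa> (W_combination \<Phi> w z)"
proof (rule field_le_epsilon)
  fix \<epsilon> :: real assume "0 < \<epsilon>"
  let ?n = "real CARD('t)"
  have n: "0 < ?n" by simp
  define \<delta> where "\<delta> = \<epsilon> / ?n"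
  have \<delta>: "0 < \<delta>" using \<open>0 < \<epsilon>\<close> n by (simp add: \<delta>_def)
  define s where "s = W_combination \<Phi> w z"
  define s' where "s' = W_combination \<Phi> (\<lambda>\<sigma>. w \<sigma> - \<delta>) z"
  have quads: "quad_coord s' q = quad_coord s q + \<delta>" for q
    by (cases q) (simp add: s_def s'_def W_combination_coords [OF K])
  have tris: "tri_coord s' p = tri_coord s p - \<delta>" for p
    by (cases p) (simp add: s_def s'_def W_combination_coords [OF K])
  have pos: "0 < quad_coord s' q" for q
    unfolding quads using nonneg [rule_format, of q] \<delta> by (simp add: s_def)
  then have "chi_star \<Phi> s' < chi_area_curvature \<Phi> A \<kappa> s'"
    using strict W_combination_in_solution_space [OF K] by (simp add: s'_def less_imp_le)
  moreover have "chi_star \<Phi> s' = chi_star \<Phi> s - \<epsilon>"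
    by (simp add: s_def s'_def chi_star_W_combination [OF K] sum_subtractf \<delta>_def)
  moreover have "chi_area_curvature \<Phi> A \<kappa> s' \<le> chi_area_curvature \<Phi> A \<kappa> s"
  proof -
    have "(\<Sum>p\<in>UNIV. tri_coord s' p * A p) \<le> (\<Sum>p\<in>UNIV. tri_coord s p * A p)"
      using A [rule_format] \<delta> by (intro sum_mono mult_right_mono) (simp_all add: tris)
    then show ?thesis
      unfolding chi_area_curvature_W_combination [OF K s_def]
        chi_area_curvature_W_combination [OF K s'_def]
      by (intro mult_left_mono add_right_mono) simp_all
  qed
  ultimately show "chi_star \<Phi> (W_combination \<Phi> w z) \<le>
      chi_area_curvature \<Phi> A \<kappa> (W_combination \<Phi> w z) + \<epsilon>"
    by (simp add: s_def)
qed

theorem proposition18: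
  fixes \<Phi> :: "'t::finite pairing set"
    and A :: "'t \<times> 4 \<Rightarrow> real"
    and \<kappa> :: "'t cell set \<Rightarrow> real"
  assumes "triangulated_pseudo_manifold \<Phi>"
    and "\<forall>p. A p \<ge> 0"
  shows "((\<forall>s \<in> solution_space \<Phi>. (\<forall>q. quad_coord s q \<ge> 0) \<longrightarrow>
             chi_star \<Phi> s \<le> chi_area_curvature \<Phi> A \<kappa> s) \<longrightarrow>
          (\<exists>\<theta>. semi_angle_structure \<Phi> A \<kappa> \<theta>)) \<and>
         ((\<forall>s \<in> solution_space \<Phi>. (\<forall>q. quad_coord s q \<ge> 0) \<and> (\<exists>q. quad_coord s q > 0) \<longrightarrow>
             chi_star \<Phi> s < chi_area_curvature \<Phi> A \<kappa> s) \<longrightarrow>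
          (\<exists>\<theta>. angle_structure \<Phi> A \<kappa> \<theta>))"
proof (intro conjI impI)
  note K = assms(1)
  let ?J = "UNIV \<times> simplex_edges :: 't cell set"
  let ?b = "area_curvature_vec \<Phi> A \<kappa>"
  have fin: "finite ?J" by simp
  have sol: "dual_normal_vec \<Phi> y \<in> solution_space \<Phi>" for y
    unfolding dual_normal_vec_def by (rule W_combination_in_solution_space [OF K])
  have quads: "\<forall>q. 0 \<le> quad_coord (dual_normal_vec \<Phi> y) q" if "\<forall>x\<in>?J. 0 \<le> y \<bullet> wedge_vec \<Phi> x" for y
  proof
    fix q :: "'t \<times> quad"
    obtain \<sigma> r where q: "q = (\<sigma>, r)" by (metis surj_pair)
    have "quad_sides r \<subseteq> simplex_edges" by (rule quad_sidesE [of r]) auto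
    then show "0 \<le> quad_coord (dual_normal_vec \<Phi> y) q"
      unfolding q quad_coord_dual_normal_vec [OF K] using that by (intro sum_nonneg) auto
  qed
  have weak: "0 \<le> y \<bullet> ?b" if "\<forall>x\<in>?J. 0 \<le> y \<bullet> wedge_vec \<Phi> x"
      and le: "chi_star \<Phi> (dual_normal_vec \<Phi> y) \<le> chi_area_curvature \<Phi> A \<kappa> (dual_normal_vec \<Phi> y)" for y
    using chi_gap_dual_normal_vec_le [OF assms that(1), of \<kappa>] le
    by (smt (verit) mult_nonneg_nonneg pi_gt_zero)
  {
    assume hyp: "\<forall>s \<in> solution_space \<Phi>. (\<forall>q. quad_coord s q \<ge> 0) \<longrightarrow>
             chi_star \<Phi> s \<le> chi_area_curvature \<Phi> A \<kappa> s"
    have dual: "0 \<le> y \<bullet> ?b" if "\<forall>x\<in>?J. 0 \<le> y \<bullet> wedge_vec \<Phi> x" for y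
    proof (rule weak [OF that])
      show "chi_star \<Phi> (dual_normal_vec \<Phi> y) \<le> chi_area_curvature \<Phi> A \<kappa> (dual_normal_vec \<Phi> y)"
        using hyp sol [of y] quads [OF that] by blast
    qed
    obtain \<theta> where "\<forall>x\<in>?J. 0 \<le> \<theta> x" "(\<Sum>x\<in>?J. \<theta> x *\<^sub>R wedge_vec \<Phi> x) = ?b"
      by (rule farkas_nonneg [OF fin dual])
    then have "semi_angle_structure \<Phi> A \<kappa> \<theta>"
      unfolding semi_angle_structure_def by (intro conjI has_area_curvatureI [OF K])
    then show "\<exists>\<theta>. semi_angle_structure \<Phi> A \<kappa> \<theta>" by blast
  next
    assume hyp: "\<forall>s \<in> solution_space \<Phi>. (\<forall>q. quad_coord s q \<ge> 0) \<and> (\<exists>q. quad_coord s q > 0) \<longrightarrow>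
             chi_star \<Phi> s < chi_area_curvature \<Phi> A \<kappa> s"
    have nonneg: "0 \<le> y \<bullet> ?b" if "\<forall>x\<in>?J. 0 \<le> y \<bullet> wedge_vec \<Phi> x" for y
    proof (rule weak [OF that])
      show "chi_star \<Phi> (dual_normal_vec \<Phi> y) \<le> chi_area_curvature \<Phi> A \<kappa> (dual_normal_vec \<Phi> y)"
        using quads [OF that] unfolding dual_normal_vec_def
        by (rule chi_star_le_of_strict [OF assms hyp])
    qed
    have pos: "0 < y \<bullet> ?b" if y: "\<forall>x\<in>?J. 0 \<le> y \<bullet> wedge_vec \<Phi> x"
        and ex: "\<exists>x\<in>?J. 0 < y \<bullet> wedge_vec \<Phi> x" for y
    proof -
      obtain \<sigma> e where e: "e \<in> simplex_edges" "0 < y \<bullet> wedge_vec \<Phi> (\<sigma>, e)"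
        using ex by auto
      obtain r where r: "quad_sides r = {e, - e}"
      proof -
        have "{e, - e} \<in> range quad_sides"
          unfolding type_definition.Rep_range [OF type_definition_quad] using e(1) by blast
        with that show thesis by (metis imageE)
      qed
      have "- e \<in> simplex_edges" using e(1) by (simp add: simplex_edges_def card_Compl_4)
      then have "0 \<le> y \<bullet> wedge_vec \<Phi> (\<sigma>, - e)" using y by simp
      moreover have "e \<noteq> - e" by blast
      ultimately have "0 < quad_coord (dual_normal_vec \<Phi> y) (\<sigma>, r)"
        unfolding quad_coord_dual_normal_vec [OF K] r using e(2) by simp
      then have "chi_star \<Phi> (dual_normal_vec \<Phi> y) < chi_area_curvature \<Phi> A \<kappa> (dual_normal_vec \<Phi> y)"
        using hyp sol [of y] quads [OF y] by blast
      then show ?thesis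
        using chi_gap_dual_normal_vec_le [OF assms y, of \<kappa>]
        by (smt (verit) mult_pos_pos pi_gt_zero)
    qed
    obtain \<theta> where "\<forall>x\<in>?J. 0 < \<theta> x" "(\<Sum>x\<in>?J. \<theta> x *\<^sub>R wedge_vec \<Phi> x) = ?b"
      by (rule farkas_pos [OF fin nonneg pos])
    then have "angle_structure \<Phi> A \<kappa> \<theta>"
      unfolding angle_structure_def by (intro conjI has_area_curvatureI [OF K])
    then show "\<exists>\<theta>. angle_structure \<Phi> A \<kappa> \<theta>" by blast
  }
qed

end
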